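(* Let $x,y,n,u,d,u',d',b$ be nonnegative integers, and let $U=\{s_1<\cdots<s_u\}$, $D=\{t_1<\cdots<t_d\}$, $U'=\{s'_1<\cdots<s'_{u'}\}$, $D'=\{t'_1<\cdots<t'_{d'}\}$, $B=\{k_1<\cdots<k_b\}$ be subsets of $\{1,2,\dots,\lfloor\frac{x+y+2n}{2}\rfloor\}$ such that $|U\cup D|=n$, $U\cup D=U'\cup D'$, $U\cap D=U'\cap D'$, $B\cap(U\cup D)=\emptyset$ and $2b\le x$. Then $$\frac{M_c(CS_{x,y}(U;D;B))}{M_c(CS_{x,y}(U';D';B))}=\sqrt{\frac{M(CS_{x,y}(U;D;B))}{M(CS_{x,y}(U';D';B))}}=\frac{\Delta\big(U\cup((x+y+2n+1)-D)\big)}{\Delta\big(U'\cup((x+y+2n+1)-D')\big)},$$ where equalities between ratios are understood in cross-multiplied form, i.e. $$M_c(CS_{x,y}(U;D;B))\,\Delta\big(U'\cup((x+y+2n+1)-D')\big)=M_c(CS_{x,y}(U';D';B))\,\Delta\big(U\cup((x+y+2n+1)-D)\big)$$ and $$M(CS_{x,y}(U;D;B))\,\Delta\big(U'\cup((x+y+2n+1)-D')\big)^2=M(CS_{x,y}(U';D';B))\,\Delta\big(U\cup((x+y+2n+1)-D)\big)^2.$$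
   Context: Work on the triangular lattice with unit equilateral triangles, one family of lattice lines being horizontal. A lozenge is the union of two unit triangles sharing an edge; a lozenge tiling of a region is a covering of it by lozenges contained in the region, without gaps or overlaps. Side-lengths of a hexagon (all angles $120^\circ$, sides along lattice lines) are listed clockwise from the north side. Notation: for a set $W$ of integers, $(x+y+2n+1)-W:=\{x+y+2n+1-w: w\in W\}$. For a finite set of integers $S=\{x_1<\cdots<x_p\}$, $\Delta(S):=\prod_{1\le i<j\le p}(x_j-x_i)$ (equal to $1$ if $p\le 1$). The region $CS_{x,y}(U;D;B)$: given $U,D,B$ with $|U|=u$, $|D|=d$, $|U\cup D|=n$, start with the hexagon of side-lengths $x+2n-u-d,\ y+u+d,\ y+u+d,\ x+2n-u-d,\ y+u+d,\ y+u+d$. Its axis is the horizontal lattice segment joining its west and east vertices; it has length $x+y+2n$, and its unit segments are called positions $1,2,\dots,x+y+2n$ from left to right. The up-pointing (resp. down-pointing) unit triangle at position $i$ is the one lying directly above (resp. below) the axis and having the $i$-th unit segment as an edge. Remove the up-pointing unit triangles at the positions in $U\cup((x+y+2n+1)-D)$ and the down-pointing unit triangles at the positions in $D\cup((x+y+2n+1)-U)$. Moreover, place barriers at the positions in $B\cup((x+y+2n+1)-B)$: a tiling of $CS_{x,y}(U;D;B)$ is not allowed to contain the vertical lozenge formed by the up-pointing and down-pointing unit triangles at a barrier position. $CS_{x,y}(U';D';B)$ is defined in the same way with $U',D',u',d'$ in place of $U,D,u,d$. $M(R)$ denotes the number of lozenge tilings of $R$ (respecting the barriers), and $M_c(R)$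 the number of those tilings which are centrally symmetric, i.e. invariant under the $180^\circ$ rotation about the center of the hexagon. *)

theory Defs
  imports Main "HOL-Library.Disjoint_Sets"
begin

text \<open>The lattice point \<open>(i, j)\<close> stands for \<open>i e\<^sub>1 + j e\<^sub>2\<close>, where \<open>e\<^sub>1\<close> is the unit vector pointing
  east and \<open>e\<^sub>2\<close> the unit vector at angle 60 degrees to it (pointing north-east). The third
  lattice direction is \<open>e\<^sub>1 - e\<^sub>2\<close>. A unit triangle is identified with its set of vertices, and a
  lozenge with the set of its two unit triangles.\<close>

type_synonym point = "int \<times> int"
type_synonym triangle = "point set"
type_synonym lozenge = "triangle set"
type_synonym region = "triangle set"

text \<open>Both triangles are indexed by the left endpoint of their horizontal edge.\<close>

definition up_triangle :: "point \<Rightarrow> triangle" where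
  "up_triangle = (\<lambda>(i, j). {(i, j), (i + 1, j), (i, j + 1)})"

definition down_triangle :: "point \<Rightarrow> triangle" where
  "down_triangle = (\<lambda>(i, j). {(i, j), (i + 1, j), (i + 1, j - 1)})"

definition unit_triangles :: "triangle set" where
  "unit_triangles = range up_triangle \<union> range down_triangle"

definition is_lozenge :: "lozenge \<Rightarrow> bool" where
  "is_lozenge L \<longleftrightarrow>
     (\<exists>s \<in> unit_triangles. \<exists>t \<in> unit_triangles. card (s \<inter> t) = 2 \<and> L = {s, t})"

definition is_tiling :: "region \<Rightarrow> lozenge set \<Rightarrow> bool" where
  "is_tiling R T \<longleftrightarrow> partition_on R T \<and> (\<forall>L \<in> T. is_lozenge L)"

text \<open>The hexagon with side-lengths \<open>a, b, c, a, b, c\<close> clockwise from the north side and with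
  west vertex at the origin. Its vertices, clockwise from the west one, are \<open>(0, 0)\<close>, \<open>(0, c)\<close>,
  \<open>(a, c)\<close>, \<open>(a + b, c - b)\<close>, \<open>(a + b, - b)\<close>, \<open>(b, - b)\<close>.\<close>

definition hexagon_points :: "int \<Rightarrow> int \<Rightarrow> int \<Rightarrow> point set" where
  "hexagon_points a b c =
     {(i, j). 0 \<le> i \<and> i \<le> a + b \<and> - b \<le> j \<and> j \<le> c \<and> 0 \<le> i + j \<and> i + j \<le> a + c}"

definition hexagon :: "int \<Rightarrow> int \<Rightarrow> int \<Rightarrow> region" where
  "hexagon a b c = {t \<in> unit_triangles. t \<subseteq> hexagon_points a b c}"

text \<open>Positions are numbered from 1, so position \<open>i\<close> is the segment from \<open>(i - 1, 0)\<close> to \<open>(i, 0)\<close>.\<close>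

definition up_at :: "int \<Rightarrow> triangle" where
  "up_at i = up_triangle (i - 1, 0)"

definition down_at :: "int \<Rightarrow> triangle" where
  "down_at i = down_triangle (i - 1, 0)"

definition reflect :: "int \<Rightarrow> int set \<Rightarrow> int set" where
  "reflect m W = (\<lambda>w. m - w) ` W"

definition axis_length :: "nat \<Rightarrow> nat \<Rightarrow> int set \<Rightarrow> int set \<Rightarrow> int" where
  "axis_length x y U D = int x + int y + 2 * int (card (U \<union> D))"

definition CS_region :: "nat \<Rightarrow> nat \<Rightarrow> int set \<Rightarrow> int set \<Rightarrow> region" where
  "CS_region x y U D =
     (let m = axis_length x y U D + 1;
          h = int y + int (card U) + int (card D)
      in hexagon (int x + 2 * int (card (U \<union> D)) - int (card U) - int (card D)) h h
           - (up_at ` (U \<union> reflect m D) \<union> down_at ` (D \<union> reflect m U)))"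

definition CS_tilings ::
    "nat \<Rightarrow> nat \<Rightarrow> int set \<Rightarrow> int set \<Rightarrow> int set \<Rightarrow> lozenge set set" where
  "CS_tilings x y U D B =
     {T. is_tiling (CS_region x y U D) T \<and>
         (\<forall>i \<in> B \<union> reflect (axis_length x y U D + 1) B. {up_at i, down_at i} \<notin> T)}"

text \<open>The center of the hexagon is the midpoint of its axis, which joins \<open>(0, 0)\<close> to
  \<open>(axis_length x y U D, 0)\<close>. For an axis of length \<open>l\<close> the half-turn about it is \<open>half_turn l\<close>.\<close>

definition half_turn :: "int \<Rightarrow> point \<Rightarrow> point" where
  "half_turn l = (\<lambda>(i, j). (l - i, - j))"

definition centrally_symmetric :: "int \<Rightarrow> lozenge set \<Rightarrow> bool" where
  "centrally_symmetric l T \<longleftrightarrow> (\<lambda>L. (\<lambda>t. half_turn l ` t) ` L) ` T = T"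

definition M :: "nat \<Rightarrow> nat \<Rightarrow> int set \<Rightarrow> int set \<Rightarrow> int set \<Rightarrow> nat" where
  "M x y U D B = card (CS_tilings x y U D B)"

definition M\<^sub>c :: "nat \<Rightarrow> nat \<Rightarrow> int set \<Rightarrow> int set \<Rightarrow> int set \<Rightarrow> nat" where
  "M\<^sub>c x y U D B =
     card {T \<in> CS_tilings x y U D B. centrally_symmetric (axis_length x y U D) T}"

definition \<Delta> :: "int set \<Rightarrow> int" where
  "\<Delta> S = (\<Prod>(p, q) \<in> {(p, q) \<in> S \<times> S. p < q}. q - p)"

end

theory Submission
  imports Defs "Jordan_Normal_Form.Determinant"
begin

text \<open>Cut a tiling along the axis. Let \<open>P\<close> be the set of positions of the removed up-pointing triangles,
so that the removed down-pointing ones sit at the mirror images of \<open>P\<close>, and let \<open>V\<close> be the set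
of positions at which a vertical lozenge crosses the axis. Barriers only restrict the choice of
\<open>V\<close>. The upper part of the tiling tiles a trapezoid that has lost the triangles at \<open>P \<union> V\<close> on its
base; the lower part, turned by 180 degrees, tiles the same trapezoid without the triangles at
\<open>P \<union> V*\<close>, where \<open>V*\<close> is the mirror image of \<open>V\<close>. A centrally symmetric tiling is one with
\<open>V = V*\<close> whose lower part is the turned upper part.

A trapezoid of height \<open>h\<close> with \<open>h\<close> dents at the positions \<open>S\<close> has \<open>\<Delta> S / c\<close> tilings, where
\<open>c = 0! 1! \<dots> (h - 1)!\<close> (\<open>trapezoid_count\<close>). Hence
\<open>c\<^sup>2 M = \<Sum>\<^sub>V \<Delta> (P \<union> V) \<Delta> (P \<union> V*)\<close> and \<open>c M\<^sub>c = \<Sum>\<^sub>V \<Delta> (P \<union> V)\<close>, the second sum over the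
\<open>V\<close> with \<open>V = V*\<close> (\<open>hexagon_count\<close>, \<open>hexagon_count_symmetric\<close>). Now \<open>\<Delta> (P \<union> V)\<close> is
\<open>\<Delta> P \<cdot> \<Delta> V\<close> times the product of all distances between \<open>P\<close> and \<open>V\<close>. Both in
\<open>\<Delta> (P \<union> V) \<Delta> (P \<union> V*)\<close> and, for \<open>V = V*\<close>, in \<open>\<Delta> (P \<union> V)\<close> these distances combine to a
product over \<open>p \<in> P\<close> of a function that takes the same value at \<open>p\<close> and at its mirror image. As
\<open>P\<close> consists of \<open>U\<close> and the mirror image of \<open>D\<close>, such a product depends only on \<open>U \<union> D\<close> and
\<open>U \<inter> D\<close> (\<open>prod_Un_reflect\<close>). So \<open>(\<Delta> P)\<^sup>2\<close>, respectively \<open>\<Delta> P\<close>, factors out of the sum, and the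
remaining factor is common to \<open>(U, D)\<close> and \<open>(U', D')\<close> (\<open>M_weight\<close>).

The trapezoid formula is proved by induction on the height. Cutting off the lowest strip, one
finds that the vertical lozenges on the next lattice line are the dents of a smaller trapezoid
and interlace with \<open>S\<close>, and that every interlacing set arises from exactly one tiling of the
strip (\<open>card_strip_matchings\<close>). What remains is that summing Vandermonde products over the
sequences interlacing \<open>s\<close> gives, up to a factorial, the Vandermonde product of \<open>s\<close>
(\<open>sum_vandermonde_interlacing\<close>); written as determinants in falling factorials, the sums
telescope.\<close>

section \<open>Vandermonde products and interlacing sequences\<close>

definition vandermonde :: "nat \<Rightarrow> (nat \<Rightarrow> int) \<Rightarrow> int" where
  "vandermonde n s = (\<Prod>j<n. \<Prod>i<j. s j - s i)"

text \<open>The matrix is the matrix of powers times the matrix of coefficients, and the latter is upper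
triangular with ones on the diagonal.\<close>

lemma det_monic_eq_det_powers:
  fixes s :: "nat \<Rightarrow> int" and p :: "nat \<Rightarrow> int poly"
  assumes "\<And>j. j < n \<Longrightarrow> degree (p j) = j" and "\<And>j. j < n \<Longrightarrow> lead_coeff (p j) = 1"
  shows "det (mat n n (\<lambda>(i, j). poly (p j) (s i))) = det (mat n n (\<lambda>(i, j). s i ^ j))"
proof -
  let ?V = "mat n n (\<lambda>(i, j). s i ^ j)"
  let ?C = "mat n n (\<lambda>(k, j). coeff (p j) k)"
  have "poly (p j) (s i) = (\<Sum>k<n. s i ^ k * coeff (p j) k)" if "i < n" "j < n" for i j
  proof -
    have "poly (p j) (s i) = (\<Sum>k\<le>j. coeff (p j) k * s i ^ k)"
      using assms(1)[OF that(2)] by (simp add: poly_altdef)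
    also have "\<dots> = (\<Sum>k<n. coeff (p j) k * s i ^ k)"
      using that assms(1)[OF that(2)] by (intro sum.mono_neutral_left) (auto intro: coeff_eq_0)
    finally show ?thesis by (simp add: mult.commute)
  qed
  then have "mat n n (\<lambda>(i, j). poly (p j) (s i)) = ?V * ?C"
    by (intro eq_matI) (auto simp: scalar_prod_def lessThan_atLeast0)
  moreover have "det ?C = 1"
  proof -
    have "upper_triangular ?C"
      using assms(1) by (auto simp: upper_triangular_def intro: coeff_eq_0)
    then have "det ?C = prod_list (diag_mat ?C)"
      by (rule det_upper_triangular[where n = n]) simp
    also have "\<dots> = (\<Prod>i = 0..<n. ?C $$ (i, i))"
      by (simp add: prod_list_diag_prod)
    also have "\<dots> = 1"
      using assms by (intro prod.neutral) force
    finally show ?thesis .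
  qed
  ultimately show ?thesis
    by (simp add: det_mult[of _ n])
qed

lemma monic_linear_prod:
  fixes c :: "nat \<Rightarrow> int"
  shows "degree (\<Prod>k<j. [:- c k, 1:]) = j \<and> lead_coeff (\<Prod>k<j. [:- c k, 1:]) = 1"
proof -
  have 1: "lead_coeff (\<Prod>k<j. [:- c k, 1:]) = 1"
    by (simp add: lead_coeff_prod)
  have "degree (\<Prod>k<j. [:- c k, 1:]) = (\<Sum>k<j. degree [:- c k, 1:])"
    by (rule degree_prod_eq_sum_degree) auto
  then show ?thesis using 1 by simp
qed

text \<open>As the determinant is the same for every family of monic polynomials, it may be computed with
the Newton polynomials whose roots are the nodes themselves; their matrix is lower triangular.\<close>

lemma det_monic_eq_vandermonde:
  fixes s :: "nat \<Rightarrow> int" and p :: "nat \<Rightarrow> int poly"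
  assumes "\<And>j. j < n \<Longrightarrow> degree (p j) = j" and "\<And>j. j < n \<Longrightarrow> lead_coeff (p j) = 1"
  shows "det (mat n n (\<lambda>(i, j). poly (p j) (s i))) = vandermonde n s"
proof -
  define q where "q = (\<lambda>j. \<Prod>k<j. [:- s k, 1:])"
  let ?Q = "mat n n (\<lambda>(i, j). poly (q j) (s i))"
  have "det (mat n n (\<lambda>(i, j). poly (p j) (s i))) = det ?Q"
    using det_monic_eq_det_powers[of n p s, OF assms] det_monic_eq_det_powers[of n q s] monic_linear_prod[of s]
    unfolding q_def by metis
  also have "\<dots> = prod_list (diag_mat ?Q)"
    by (rule det_lower_triangular[where n = n]) (auto simp: q_def poly_prod)
  also have "\<dots> = (\<Prod>i = 0..<n. ?Q $$ (i, i))"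
    by (simp add: prod_list_diag_prod)
  also have "\<dots> = vandermonde n s"
    unfolding vandermonde_def lessThan_atLeast0[symmetric] by (intro prod.cong) (auto simp: q_def poly_prod)
  finally show ?thesis .
qed

text \<open>The falling factorials \<open>t (t - 1) \<dots> (t - j + 1)\<close>: monic polynomials that are, up to a constant,
the forward differences of their successors, so that summation over an interval telescopes.\<close>

definition falling :: "nat \<Rightarrow> int poly" where
  "falling j = (\<Prod>k<j. [:- int k, 1:])"

lemma falling_monic: "degree (falling j) = j" "coeff (falling j) j = 1"
  unfolding falling_def using monic_linear_prod[of int j] by auto

lemma falling_difference:
  "poly (falling (Suc j)) (t + 1) - poly (falling (Suc j)) t = int (Suc j) * poly (falling j) t"
proof -
  have "poly (falling (Suc j)) (t + 1) = (t + 1) * poly (falling j) t"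
    unfolding falling_def poly_prod
    by (subst prod.lessThan_Suc_shift) simp
  moreover have "poly (falling (Suc j)) t = poly (falling j) t * (t - int j)"
    by (simp add: falling_def poly_prod algebra_simps)
  ultimately show ?thesis by (simp add: algebra_simps)
qed

lemma sum_falling:
  assumes "a \<le> b"
  shows "int (Suc j) * (\<Sum>t\<in>{a..<b}. poly (falling j) t)
    = poly (falling (Suc j)) b - poly (falling (Suc j)) a"
  using assms
proof (induction b rule: int_ge_induct)
  case (step b)
  have "{a..<b + 1} = insert b {a..<b}" using step.hyps by auto
  then show ?case
    using step.IH falling_difference[of j b] by (simp add: distrib_left)
qed simp

text \<open>Subtract from every row the row above it and expand along the first column.\<close>

lemma det_consecutive_differences:
  fixes f :: "nat \<Rightarrow> int \<Rightarrow> int" and s :: "nat \<Rightarrow> int"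
  assumes "\<And>t. f 0 t = 1"
  shows "det (mat (Suc n) (Suc n) (\<lambda>(i, j). f j (s i)))
    = det (mat n n (\<lambda>(i, j). f (Suc j) (s (Suc i)) - f (Suc j) (s i)))"
proof -
  let ?N = "mat (Suc n) (Suc n) (\<lambda>(i, j). f j (s i))"
  \<comment> \<open>left multiplication by \<open>?E\<close> subtracts from every row the row above it\<close>
  let ?E = "mat (Suc n) (Suc n) (\<lambda>(i, k). if k = i then 1 else if Suc k = i then -1 else 0) :: int mat"
  let ?D = "mat n n (\<lambda>(i, j). f (Suc j) (s (Suc i)) - f (Suc j) (s i))"
  let ?A1 = "mat 1 1 (\<lambda>_. 1) :: int mat" and ?A2 = "mat 1 n (\<lambda>(i, j). f (Suc j) (s 0))"
  have "det ?E = 1"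
    by (subst det_lower_triangular[where n = "Suc n"]) (auto simp: prod_list_diag_prod)
  moreover have "?E * ?N = four_block_mat ?A1 ?A2 (0\<^sub>m n 1) ?D" (is "_ = ?F")
  proof (rule eq_matI)
    fix i j assume "i < dim_row ?F" "j < dim_col ?F"
    then have ij: "i < Suc n" "j < Suc n" by auto
    have "(?E * ?N) $$ (i, j)
        = (\<Sum>k = 0..<Suc n. (if k = i then 1 else if Suc k = i then -1 else 0) * f j (s k))"
      using ij by (auto simp: scalar_prod_def simp del: sum.op_ivl_Suc intro!: sum.cong)
    also have "\<dots> = (\<Sum>k = 0..<Suc n. (if k = i then f j (s k) else 0)
        + (if Suc k = i then - f j (s k) else 0))"
      by (intro sum.cong) auto
    also have "\<dots> = f j (s i) + (\<Sum>k = 0..<Suc n. (if Suc k = i then - f j (s k) else 0))"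
      using ij by (simp add: sum.distrib del: sum.op_ivl_Suc)
    also have "(\<Sum>k = 0..<Suc n. (if Suc k = i then - f j (s k) else 0))
        = (case i of 0 \<Rightarrow> 0 | Suc i' \<Rightarrow> - f j (s i'))"
      using ij by (auto split: nat.split simp del: sum.op_ivl_Suc)
    finally show "(?E * ?N) $$ (i, j) = ?F $$ (i, j)"
      using ij assms by (auto split: nat.split)
  qed auto
  moreover have "det ?F = det ?D"
    by (subst det_four_block_mat_lower_left_zero_col) (auto simp: det_single)
  ultimately show ?thesis
    using det_mult[of ?E "Suc n" ?N] by simp
qed

text \<open>By multilinearity the sum over the box can be carried out inside the entries of the determinant
for falling factorials, row by row. There it telescopes to a difference of values at consecutive
\<open>s k\<close>, and the factors \<open>j + 1\<close> that the columns need for this make up the factorial.\<close>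

lemma sum_vandermonde_interlacing:
  fixes s :: "nat \<Rightarrow> int"
  assumes "\<And>k. k < n \<Longrightarrow> s k \<le> s (Suc k)"
  shows "fact n * (\<Sum>t \<in> Pi\<^sub>E {..<n} (\<lambda>k. {s k..<s (Suc k)}). vandermonde n t) = vandermonde (Suc n) s"
proof -
  let ?box = "Pi\<^sub>E {..<n} (\<lambda>k. {s k..<s (Suc k)})"
  let ?P = "{\<pi>. \<pi> permutes {..<n}}"
  let ?g = "\<lambda>i j. \<Sum>t\<in>{s i..<s (Suc i)}. poly (falling j) t"
  have leib: "det (mat n n (\<lambda>(i, j). a i j)) = (\<Sum>\<pi>\<in>?P. signof \<pi> * (\<Prod>i<n. a i (\<pi> i)))"
    for a :: "nat \<Rightarrow> nat \<Rightarrow> int"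
    by (auto simp: det_def lessThan_atLeast0 permutes_in_image intro!: sum.cong prod.cong)
  have "(\<Sum>t\<in>?box. vandermonde n t)
      = (\<Sum>t\<in>?box. \<Sum>\<pi>\<in>?P. signof \<pi> * (\<Prod>i<n. poly (falling (\<pi> i)) (t i)))"
    by (intro sum.cong refl, unfold leib[of "\<lambda>i j. poly (falling j) (t i)" for t, symmetric],
        rule det_monic_eq_vandermonde[symmetric]) (simp_all add: falling_monic)
  also have "\<dots> = (\<Sum>\<pi>\<in>?P. signof \<pi> * (\<Sum>t\<in>?box. \<Prod>i<n. poly (falling (\<pi> i)) (t i)))"
    by (subst sum.swap) (simp add: sum_distrib_left)
  also have "\<dots> = (\<Sum>\<pi>\<in>?P. signof \<pi> * (\<Prod>i<n. ?g i (\<pi> i)))"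
    by (subst prod_sum_PiE) auto
  finally have box: "(\<Sum>t\<in>?box. vandermonde n t) = (\<Sum>\<pi>\<in>?P. signof \<pi> * (\<Prod>i<n. ?g i (\<pi> i)))" .
  have fact_eq: "fact n = (\<Prod>i<n. int (Suc (\<pi> i)))" if "\<pi> permutes {..<n}" for \<pi>
    using prod.permute[OF that, of "\<lambda>i. int (Suc i)"]
    by (simp add: fact_prod_Suc lessThan_atLeast0)
  have "fact n * (\<Sum>t\<in>?box. vandermonde n t)
      = (\<Sum>\<pi>\<in>?P. fact n * (signof \<pi> * (\<Prod>i<n. ?g i (\<pi> i))))"
    unfolding box by (rule sum_distrib_left)
  also have "\<dots> = (\<Sum>\<pi>\<in>?P. signof \<pi> * (\<Prod>i<n. int (Suc (\<pi> i)) * ?g i (\<pi> i)))"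
    by (intro sum.cong refl, subst prod.distrib, subst fact_eq) auto
  also have "\<dots> = det (mat n n (\<lambda>(i, j). int (Suc j) * ?g i j))"
    by (simp add: leib)
  also have "mat n n (\<lambda>(i, j). int (Suc j) * ?g i j)
      = mat n n (\<lambda>(i, j). poly (falling (Suc j)) (s (Suc i)) - poly (falling (Suc j)) (s i))"
    using assms by (intro cong_mat) (auto simp: sum_falling simp del: of_nat_Suc)
  also have "det \<dots> = det (mat (Suc n) (Suc n) (\<lambda>(i, j). poly (falling j) (s i)))"
    by (rule det_consecutive_differences[symmetric]) (simp add: falling_def)
  also have "\<dots> = vandermonde (Suc n) s"
    by (rule det_monic_eq_vandermonde) (auto simp: falling_monic)
  finally show ?thesis .
qed

section \<open>Matchings between up-pointing and down-pointing triangles\<close>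

text \<open>The up-pointing triangle with index \<open>p\<close> shares an edge with the down-pointing triangle with index
\<open>q\<close>: its horizontal, its left and its right edge in this order. So the three alternatives are
the three kinds of lozenges, the first being the vertical one.\<close>

definition adj :: "point \<Rightarrow> point \<Rightarrow> bool" where
  "adj p q \<longleftrightarrow> q = p \<or> q = (fst p - 1, snd p + 1) \<or> q = (fst p, snd p + 1)"

text \<open>Tilings of a region are encoded as the perfect matchings between the indices \<open>A\<close> of its
up-pointing and the indices \<open>E\<close> of its down-pointing triangles. A relation is used rather than a
function so that a matching can be cut into pieces and put together again as a set.\<close>

definition matchings :: "point set \<Rightarrow> point set \<Rightarrow> (point \<times> point) set set" where
  "matchings A E = {\<mu>. (\<forall>(p, q) \<in> \<mu>. adj p q) \<and> Domain \<mu> = A \<and> Range \<mu> = E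
     \<and> single_valued \<mu> \<and> single_valued (\<mu>\<inverse>)}"

lemma matchingsD:
  assumes "\<mu> \<in> matchings A E"
  shows "(p, q) \<in> \<mu> \<Longrightarrow> adj p q" "(p, q) \<in> \<mu> \<Longrightarrow> p \<in> A" "(p, q) \<in> \<mu> \<Longrightarrow> q \<in> E"
    "(p, q) \<in> \<mu> \<Longrightarrow> (p, q') \<in> \<mu> \<Longrightarrow> q = q'" "(p, q) \<in> \<mu> \<Longrightarrow> (p', q) \<in> \<mu> \<Longrightarrow> p = p'"
    "p \<in> A \<Longrightarrow> \<exists>q. (p, q) \<in> \<mu>" "q \<in> E \<Longrightarrow> \<exists>p. (p, q) \<in> \<mu>"
  using assms unfolding matchings_def single_valued_def by fast+

lemma matchingsI:
  assumes "\<And>p q. (p, q) \<in> \<mu> \<Longrightarrow> adj p q \<and> p \<in> A \<and> q \<in> E"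
    and "\<And>p q q'. (p, q) \<in> \<mu> \<Longrightarrow> (p, q') \<in> \<mu> \<Longrightarrow> q = q'"
    and "\<And>p p' q. (p, q) \<in> \<mu> \<Longrightarrow> (p', q) \<in> \<mu> \<Longrightarrow> p = p'"
    and "\<And>p. p \<in> A \<Longrightarrow> \<exists>q. (p, q) \<in> \<mu>" and "\<And>q. q \<in> E \<Longrightarrow> \<exists>p. (p, q) \<in> \<mu>"
  shows "\<mu> \<in> matchings A E"
proof -
  have "Domain \<mu> = A" using assms(1,4) by blast
  moreover have "Range \<mu> = E" using assms(1,5) by blast
  moreover have "single_valued \<mu>" using assms(2) by (auto intro: single_valuedI)
  moreover have "single_valued (\<mu>\<inverse>)" using assms(3) by (auto intro!: single_valuedI)
  ultimately show ?thesis using assms(1) unfolding matchings_def by blast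
qed

lemma finite_matchings:
  assumes "finite A" and "finite E"
  shows "finite (matchings A E)"
proof (rule finite_subset)
  show "matchings A E \<subseteq> Pow (A \<times> E)" by (auto simp: matchings_def)
qed (use assms in simp)

text \<open>The form in which matchings yield counting constraints: two sets of triangles that exhaust each
other's partners are equinumerous, even if they are only part of the matched region.\<close>

lemma matching_card_restrict:
  assumes \<mu>: "\<mu> \<in> matchings A E" and "A' \<subseteq> A" and "E' \<subseteq> E"
    and iff: "\<And>p q. (p, q) \<in> \<mu> \<Longrightarrow> p \<in> A' \<longleftrightarrow> q \<in> E'"
  shows "card A' = card E'"
proof (rule bij_betw_same_card)
  define f where "f = (\<lambda>p. THE q. (p, q) \<in> \<mu>)"
  have f: "f p = q" if "(p, q) \<in> \<mu>" for p q
    unfolding f_def using that matchingsD(4)[OF \<mu>] by blast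
  show "bij_betw f A' E'"
    unfolding bij_betw_def
  proof (intro conjI inj_onI equalityI subsetI)
    fix p p' assume "p \<in> A'" "p' \<in> A'" "f p = f p'"
    then obtain q q' where "(p, q) \<in> \<mu>" "(p', q') \<in> \<mu>"
      using assms(2) matchingsD(6)[OF \<mu>] by blast
    then show "p = p'" using \<open>f p = f p'\<close> matchingsD(5)[OF \<mu>] f by metis
  next
    fix q assume "q \<in> f ` A'"
    then obtain p where "p \<in> A'" "q = f p" by blast
    moreover obtain q' where "(p, q') \<in> \<mu>" using \<open>p \<in> A'\<close> assms(2) matchingsD(6)[OF \<mu>] by blast
    ultimately show "q \<in> E'" using f iff by metis
  next
    fix q assume "q \<in> E'"
    then obtain p where "(p, q) \<in> \<mu>" using assms(3) matchingsD(7)[OF \<mu>] by blast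
    then show "q \<in> f ` A'" using f iff \<open>q \<in> E'\<close> by blast
  qed
qed

text \<open>The columns of the vertical lozenges that cross the lattice line at height \<open>k\<close>, and the parts of
the matching below and above this line. Up-pointing triangles in row \<open>j\<close> lie above the line at
height \<open>j\<close>, down-pointing ones below it.\<close>

definition split_at_row :: "int \<Rightarrow> (point \<times> point) set \<Rightarrow> int set \<times> (point \<times> point) set \<times> (point \<times> point) set" where
  "split_at_row k \<mu> = ({i. ((i, k), (i, k)) \<in> \<mu>}, {(p, q) \<in> \<mu>. snd p < k}, {(p, q) \<in> \<mu>. snd q > k})"

definition join_at_row :: "int \<Rightarrow> int set \<times> (point \<times> point) set \<times> (point \<times> point) set \<Rightarrow> (point \<times> point) set" where
  "join_at_row k = (\<lambda>(V, \<mu>\<^sub>1, \<mu>\<^sub>2). (\<lambda>i. ((i, k), (i, k))) ` V \<union> \<mu>\<^sub>1 \<union> \<mu>\<^sub>2)"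

lemma adj_rows: "adj p q \<Longrightarrow> snd q = snd p \<and> q = p \<or> snd q = snd p + 1"
  by (auto simp: adj_def)

lemma join_split_at_row:
  assumes "\<mu> \<in> matchings A E"
  shows "join_at_row k (split_at_row k \<mu>) = \<mu>"
proof -
  have "snd p < k \<or> snd q > k \<or> (\<exists>i. p = (i, k) \<and> q = (i, k))" if "(p, q) \<in> \<mu>" for p q
    using adj_rows[OF matchingsD(1)[OF assms that]] by (cases p; cases q) auto
  then show ?thesis
    unfolding join_at_row_def split_at_row_def by fastforce
qed

text \<open>The possible parts below and above the line at height \<open>k\<close> if it is crossed in the columns \<open>V\<close>:
both triangles of a crossing lozenge are missing, the down-pointing one below the line and the
up-pointing one above it.\<close>

definition halves :: "int \<Rightarrow> point set \<Rightarrow> point set \<Rightarrow> int set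
    \<Rightarrow> ((point \<times> point) set \<times> (point \<times> point) set) set" where
  "halves k A E V =
     matchings {p \<in> A. snd p < k} ({q \<in> E. snd q \<le> k} - V \<times> {k})
       \<times> matchings ({p \<in> A. snd p \<ge> k} - V \<times> {k}) {q \<in> E. snd q > k}"

text \<open>Adjacent triangles on different sides of the line form a vertical lozenge on it. So once the
crossing columns are fixed, the two sides are matched independently of each other.\<close>

lemma bij_betw_split_at_row:
  "bij_betw (split_at_row k) (matchings A E) (SIGMA V : Pow {i. (i, k) \<in> A \<inter> E}. halves k A E V)"
proof (rule bij_betw_byWitness[where f' = "join_at_row k"])
  show "\<forall>\<mu>\<in>matchings A E. join_at_row k (split_at_row k \<mu>) = \<mu>" using join_split_at_row by blast
next
  show "split_at_row k ` matchings A E \<subseteq> (SIGMA V : Pow {i. (i, k) \<in> A \<inter> E}. halves k A E V)"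
  proof clarify
    fix \<mu> V \<mu>\<^sub>1 \<mu>\<^sub>2 assume \<mu>: "\<mu> \<in> matchings A E" and c: "(V, \<mu>\<^sub>1, \<mu>\<^sub>2) = split_at_row k \<mu>"
    note D = matchingsD[OF \<mu>]
    have V: "i \<in> V \<longleftrightarrow> ((i, k), (i, k)) \<in> \<mu>" for i using c by (simp add: split_at_row_def)
    have m1: "(p, q) \<in> \<mu>\<^sub>1 \<longleftrightarrow> (p, q) \<in> \<mu> \<and> snd p < k" for p q using c by (simp add: split_at_row_def)
    have m2: "(p, q) \<in> \<mu>\<^sub>2 \<longleftrightarrow> (p, q) \<in> \<mu> \<and> snd q > k" for p q using c by (simp add: split_at_row_def)
    have "\<mu>\<^sub>1 \<in> matchings {p \<in> A. snd p < k} ({q \<in> E. snd q \<le> k} - V \<times> {k})"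
    proof (rule matchingsI, goal_cases)
      case (1 p q)
      then have pq: "(p, q) \<in> \<mu>" "snd p < k" by (auto simp: m1)
      have "q \<notin> V \<times> {k}" using pq D(5)[OF pq(1)] by (force simp: V)
      then show ?case using pq D(1-3) adj_rows[OF D(1)[OF pq(1)]] by auto
    next
      case (5 q)
      then obtain p where p: "(p, q) \<in> \<mu>" using D(7) by blast
      have "snd p < k"
        using adj_rows[OF D(1)[OF p]] 5 p by (cases p; cases q; cases "snd q = k") (auto simp: V)
      then show ?case using p m1 by blast
    qed (use D m1 in \<open>blast+\<close>)
    moreover have "\<mu>\<^sub>2 \<in> matchings ({p \<in> A. snd p \<ge> k} - V \<times> {k}) {q \<in> E. snd q > k}"
    proof (rule matchingsI, goal_cases)
      case (1 p q)
      then have pq: "(p, q) \<in> \<mu>" "snd q > k" by (auto simp: m2)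
      have "p \<notin> V \<times> {k}" using pq D(4)[OF pq(1)] by (force simp: V)
      then show ?case using pq D(1-3) adj_rows[OF D(1)[OF pq(1)]] by auto
    next
      case (4 p)
      then obtain q where q: "(p, q) \<in> \<mu>" using D(6) by blast
      have "snd q > k"
        using adj_rows[OF D(1)[OF q]] 4 q by (cases p; cases q; cases "snd p = k") (auto simp: V)
      then show ?case using q m2 by blast
    qed (use D m2 in \<open>blast+\<close>)
    ultimately show "V \<in> Pow {i. (i, k) \<in> A \<inter> E} \<and> (\<mu>\<^sub>1, \<mu>\<^sub>2) \<in> halves k A E V"
      using D(2,3) V by (auto simp: halves_def)
  qed
next
  show "\<forall>x\<in>(SIGMA V : Pow {i. (i, k) \<in> A \<inter> E}. halves k A E V). split_at_row k (join_at_row k x) = x"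
  proof clarify
    fix V \<mu>\<^sub>1 \<mu>\<^sub>2 assume "(\<mu>\<^sub>1, \<mu>\<^sub>2) \<in> halves k A E V"
    then have \<mu>: "\<mu>\<^sub>1 \<in> matchings {p \<in> A. snd p < k} ({q \<in> E. snd q \<le> k} - V \<times> {k})"
      "\<mu>\<^sub>2 \<in> matchings ({p \<in> A. snd p \<ge> k} - V \<times> {k}) {q \<in> E. snd q > k}"
      by (auto simp: halves_def)
    have N: "snd p < k \<and> snd q \<le> k" if "(p, q) \<in> \<mu>\<^sub>1" for p q
      using matchingsD(2,3)[OF \<mu>(1) that] by auto
    have N': "k \<le> snd p \<and> k < snd q" if "(p, q) \<in> \<mu>\<^sub>2" for p q
      using matchingsD(2,3)[OF \<mu>(2) that] by auto
    show "split_at_row k (join_at_row k (V, \<mu>\<^sub>1, \<mu>\<^sub>2)) = (V, \<mu>\<^sub>1, \<mu>\<^sub>2)"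
      unfolding split_at_row_def join_at_row_def by (auto dest: N N')
  qed
next
  show "join_at_row k ` (SIGMA V : Pow {i. (i, k) \<in> A \<inter> E}. halves k A E V) \<subseteq> matchings A E"
  proof clarify
    fix V \<mu>\<^sub>1 \<mu>\<^sub>2 assume V: "V \<subseteq> {i. (i, k) \<in> A \<inter> E}" and "(\<mu>\<^sub>1, \<mu>\<^sub>2) \<in> halves k A E V"
    then have \<mu>: "\<mu>\<^sub>1 \<in> matchings {p \<in> A. snd p < k} ({q \<in> E. snd q \<le> k} - V \<times> {k})"
      "\<mu>\<^sub>2 \<in> matchings ({p \<in> A. snd p \<ge> k} - V \<times> {k}) {q \<in> E. snd q > k}"
      by (auto simp: halves_def)
    note D = matchingsD[OF \<mu>(1)] matchingsD[OF \<mu>(2)]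
    have g: "(p, q) \<in> join_at_row k (V, \<mu>\<^sub>1, \<mu>\<^sub>2) \<longleftrightarrow>
        (p \<in> V \<times> {k} \<and> q = p) \<or> (p, q) \<in> \<mu>\<^sub>1 \<or> (p, q) \<in> \<mu>\<^sub>2" for p q
      unfolding join_at_row_def by auto
    have N1: "p \<in> A" "q \<in> E" "snd p < k" "q \<notin> V \<times> {k}" "snd q \<le> k" if "(p, q) \<in> \<mu>\<^sub>1" for p q
      using D(2)[OF that] D(3)[OF that] by auto
    have N2: "p \<in> A" "q \<in> E" "snd p \<ge> k" "p \<notin> V \<times> {k}" "snd q > k" if "(p, q) \<in> \<mu>\<^sub>2" for p q
      using D(9)[OF that] D(10)[OF that] by auto
    have N3: "p \<in> A" "p \<in> E" "snd p = k" if "p \<in> V \<times> {k}" for p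
      using that V by auto
    show "join_at_row k (V, \<mu>\<^sub>1, \<mu>\<^sub>2) \<in> matchings A E"
    proof (rule matchingsI, goal_cases)
      case (1 p q)
      then show ?case using N1(1,2)[of p q] N2(1,2)[of p q] N3(1,2)[of p] D(1)[of p q] D(8)[of p q]
        unfolding g by (auto simp: adj_def)
    next
      case (2 p q q')
      consider "p \<in> V \<times> {k}" | "p \<notin> V \<times> {k}" "snd p < k" | "p \<notin> V \<times> {k}" "snd p \<ge> k"
        by linarith
      then show ?case
      proof cases
        case 1
        then have "(p, r) \<notin> \<mu>\<^sub>1" "(p, r) \<notin> \<mu>\<^sub>2" for r
          using N1(3)[of p r] N2(4)[of p r] N3(3)[of p] by auto
        then show ?thesis using 2 unfolding g by blast
      next
        case c: 2
        then have "(p, r) \<notin> \<mu>\<^sub>2" for r using N2(3)[of p r] by auto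
        then show ?thesis using 2 c(1) D(4)[of p q q'] unfolding g by blast
      next
        case 3
        then have "(p, r) \<notin> \<mu>\<^sub>1" for r using N1(3)[of p r] by auto
        then show ?thesis using 2 3(1) D(11)[of p q q'] unfolding g by blast
      qed
    next
      case (3 p p' q)
      consider "q \<in> V \<times> {k}" | "q \<notin> V \<times> {k}" "snd q \<le> k" | "q \<notin> V \<times> {k}" "snd q > k"
        by linarith
      then show ?case
      proof cases
        case 1
        then have "(r, q) \<notin> \<mu>\<^sub>1" "(r, q) \<notin> \<mu>\<^sub>2" for r
          using N1(4)[of r q] N2(5)[of r q] N3(3)[of q] by auto
        then show ?thesis using 3 unfolding g by blast
      next
        case 2
        then have "(r, q) \<notin> \<mu>\<^sub>2" for r using N2(5)[of r q] by auto
        then show ?thesis using 3 2(1) D(5)[of p q p'] unfolding g by blast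
      next
        case c: 3
        then have "(r, q) \<notin> \<mu>\<^sub>1" for r using N1(5)[of r q] by auto
        then show ?thesis using 3 c(1) D(12)[of p q p'] unfolding g by blast
      qed
    next
      case (4 p)
      then show ?case using D(6)[of p] D(13)[of p] unfolding g
        by (cases "p \<in> V \<times> {k}"; cases "snd p < k") auto
    next
      case (5 q)
      then show ?case using D(7)[of q] D(14)[of q] unfolding g
        by (cases "q \<in> V \<times> {k}"; cases "snd q \<le> k") auto
    qed
  qed
qed

text \<open>The half-turn acting on indices. It exchanges up-pointing and down-pointing triangles and the left
and the right endpoint of the horizontal edge; the latter causes the shift by one.\<close>

definition turn :: "int \<Rightarrow> point \<Rightarrow> point" where
  "turn l = (\<lambda>(i, j). (l - 1 - i, - j))"

text \<open>The components of a pair are exchanged because an up-pointing triangle becomes a down-pointing one.\<close>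

definition turn_matching :: "int \<Rightarrow> (point \<times> point) set \<Rightarrow> (point \<times> point) set" where
  "turn_matching l \<mu> = (\<lambda>(p, q). (turn l q, turn l p)) ` \<mu>"

lemma turn_turn [simp]: "turn l (turn l p) = p"
  by (cases p) (simp add: turn_def)

lemma in_turn_matching: "(p, q) \<in> turn_matching l \<mu> \<longleftrightarrow> (turn l q, turn l p) \<in> \<mu>"
  by (auto simp: turn_matching_def intro: rev_image_eqI[where x = "(turn l q, turn l p)"])

lemma turn_matching_turn_matching [simp]: "turn_matching l (turn_matching l \<mu>) = \<mu>"
  by (auto simp: in_turn_matching)

lemma in_turn_image: "p \<in> turn l ` A \<longleftrightarrow> turn l p \<in> A"
  by (auto intro: rev_image_eqI[where x = "turn l p"])

lemma adj_turn: "adj (turn l q) (turn l p) \<longleftrightarrow> adj p q"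
  by (cases p; cases q) (auto simp: adj_def turn_def)

lemma turn_matching_in_matchings:
  assumes "\<mu> \<in> matchings A E"
  shows "turn_matching l \<mu> \<in> matchings (turn l ` E) (turn l ` A)"
proof (rule matchingsI, unfold in_turn_matching in_turn_image, goal_cases)
  case (1 p q)
  then show ?case using matchingsD(1-3)[OF assms 1] by (simp add: adj_turn)
next
  case (2 p q q')
  then show ?case using matchingsD(5)[OF assms] by (metis turn_turn)
next
  case (3 p p' q)
  then show ?case using matchingsD(4)[OF assms] by (metis turn_turn)
next
  case (4 p)
  then show ?case using matchingsD(7)[OF assms] by (metis turn_turn)
next
  case (5 q)
  then show ?case using matchingsD(6)[OF assms] by (metis turn_turn)
qed

lemma bij_betw_turn_matching:
  "bij_betw (turn_matching l) (matchings A E) (matchings (turn l ` E) (turn l ` A))"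
proof (rule bij_betw_byWitness[where f' = "turn_matching l"])
  have turn2: "turn l ` turn l ` X = X" for X by (simp add: image_image)
  show "turn_matching l ` matchings (turn l ` E) (turn l ` A) \<subseteq> matchings A E"
    using turn_matching_in_matchings[of _ "turn l ` E" "turn l ` A" l] unfolding turn2 by blast
  show "turn_matching l ` matchings A E \<subseteq> matchings (turn l ` E) (turn l ` A)"
    using turn_matching_in_matchings by blast
qed simp_all

section \<open>A single horizontal strip\<close>

abbreviation strip_matchings :: "int \<Rightarrow> int set \<Rightarrow> int set \<Rightarrow> (point \<times> point) set set" where
  "strip_matchings k X Y \<equiv> matchings (X \<times> {k}) (Y \<times> {k + 1})"

text \<open>Go from left to right. If the first disagreement occurs at \<open>i\<close>, then one matching pairs \<open>i\<close> with
its left neighbour and the other with its right neighbour. In the second one the left neighbour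
of \<open>i\<close> must be the partner of \<open>i - 1\<close>. By minimality this pair also occurs in the first matching,
where that triangle is already the partner of \<open>i\<close>.\<close>

lemma strip_matching_unique:
  assumes \<mu>: "\<mu> \<in> strip_matchings k X Y" and \<nu>: "\<nu> \<in> strip_matchings k X Y" and "X \<subseteq> {0..}"
  shows "\<mu> = \<nu>"
proof -
  have step: "((i, k), i, k + 1) \<notin> \<beta>"
    if \<alpha>: "\<alpha> \<in> strip_matchings k X Y" and \<beta>: "\<beta> \<in> strip_matchings k X Y"
      and left: "((i, k), i - 1, k + 1) \<in> \<alpha>"
      and IH: "\<And>q. ((i - 1, k), q) \<in> \<beta> \<Longrightarrow> ((i - 1, k), q) \<in> \<alpha>" for \<alpha> \<beta> i
  proof
    assume right: "((i, k), i, k + 1) \<in> \<beta>"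
    have "(i - 1, k + 1) \<in> Y \<times> {k + 1}" using matchingsD(3)[OF \<alpha> left] .
    then obtain p where p: "(p, i - 1, k + 1) \<in> \<beta>" using matchingsD(7)[OF \<beta>] by blast
    have "snd p = k" using matchingsD(2)[OF \<beta> p] by auto
    then have "p = (i, k) \<or> p = (i - 1, k)"
      using matchingsD(1)[OF \<beta> p] by (cases p) (auto simp: adj_def)
    moreover have "p \<noteq> (i, k)" using matchingsD(4)[OF \<beta> right, of "(i - 1, k + 1)"] p by auto
    ultimately have "((i - 1, k), i - 1, k + 1) \<in> \<alpha>" using p IH by auto
    then show False using matchingsD(5)[OF \<alpha> left, of "(i - 1, k)"] by auto
  qed
  have partner: "q = (i, k + 1) \<or> q = (i - 1, k + 1)"
    if "\<alpha> \<in> strip_matchings k X Y" "((i, k), q) \<in> \<alpha>" for \<alpha> i q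
    using matchingsD(1,3)[OF that] by (auto simp: adj_def)
  \<comment> \<open>\<open>step\<close> excludes both ways in which the two matchings could disagree at \<open>i\<close>\<close>
  have agree: "((int m, k), q) \<in> \<mu> \<longleftrightarrow> ((int m, k), q) \<in> \<nu>" for m q
  proof (induction m arbitrary: q)
    case 0
    have "((- 1, k), q) \<notin> \<mu>" "((- 1, k), q) \<notin> \<nu>" for q
      using assms(3) matchingsD(2)[OF \<mu>, of "(- 1, k)" q] matchingsD(2)[OF \<nu>, of "(- 1, k)" q]
      by auto
    then show ?case
      using step[OF \<mu> \<nu>, of 0] step[OF \<nu> \<mu>, of 0] partner[OF \<mu>, of 0] partner[OF \<nu>, of 0]
        matchingsD(2,6)[OF \<mu>, of "(0, k)"] matchingsD(2,6)[OF \<nu>, of "(0, k)"]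
      by (metis diff_0 of_nat_0)
  next
    case (Suc m)
    have "((int (Suc m) - 1, k), q) \<in> \<mu> \<longleftrightarrow> ((int (Suc m) - 1, k), q) \<in> \<nu>" for q
      using Suc[of q] by simp
    then show ?case
      using step[OF \<mu> \<nu>, of "int (Suc m)"] step[OF \<nu> \<mu>, of "int (Suc m)"]
        partner[OF \<mu>, of "int (Suc m)"] partner[OF \<nu>, of "int (Suc m)"]
        matchingsD(2,6)[OF \<mu>, of "(int (Suc m), k)"] matchingsD(2,6)[OF \<nu>, of "(int (Suc m), k)"]
      by metis
  qed
  have "(p, q) \<in> \<mu> \<longleftrightarrow> (p, q) \<in> \<nu>" for p q
  proof (cases "p \<in> {0..} \<times> {k}")
    case True
    then show ?thesis using agree[of "nat (fst p)" q] by (cases p) auto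
  next
    case False
    then have "p \<notin> X \<times> {k}" using assms(3) by auto
    then show ?thesis using matchingsD(2)[OF \<mu>] matchingsD(2)[OF \<nu>] by blast
  qed
  then show ?thesis by auto
qed

text \<open>The domain is made extensional in order that distinct sequences have distinct sets of entries.\<close>

definition interlacing :: "nat \<Rightarrow> (nat \<Rightarrow> int) \<Rightarrow> (nat \<Rightarrow> int) set" where
  "interlacing n s = Pi\<^sub>E {..<n} (\<lambda>j. {s j..<s (Suc j)})"

lemma gap_unique:
  fixes s :: "nat \<Rightarrow> int"
  assumes s: "strict_mono_on {..n} s" and "i < n" "j < n"
    and "s i \<le> x" "x < s (Suc i)" "s j \<le> x" "x < s (Suc j)"
  shows "i = j"
proof (rule ccontr)
  assume "i \<noteq> j"
  then consider "Suc i \<le> j" | "Suc j \<le> i" by linarith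
  then show False
    using strict_mono_on_leD[OF s, of "Suc i" j] strict_mono_on_leD[OF s, of "Suc j" i] assms(2-)
    by cases auto
qed

lemma inj_on_interlacing_image:
  assumes s: "strict_mono_on {..n} s"
  shows "inj_on (\<lambda>t. t ` {..<n}) (interlacing n s)"
proof (rule inj_onI)
  fix t t' assume t: "t \<in> interlacing n s" and t': "t' \<in> interlacing n s"
    and eq: "t ` {..<n} = t' ` {..<n}"
  show "t = t'"
  proof (rule PiE_ext)
    fix j assume "j \<in> {..<n}"
    then obtain i where "i < n" "t j = t' i" using eq by (metis imageE imageI lessThan_iff)
    moreover have "s j \<le> t j" "t j < s (Suc j)" "s i \<le> t' i" "t' i < s (Suc i)"
      using t t' \<open>i < n\<close> \<open>j \<in> {..<n}\<close> by (auto simp: interlacing_def PiE_iff)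
    ultimately show "t j = t' j" using gap_unique[OF s, of i j "t j"] \<open>j \<in> {..<n}\<close> by auto
  qed (use t t' in \<open>auto simp: interlacing_def\<close>)
qed

text \<open>Strictly between \<open>s j\<close> and \<open>s (j + 1)\<close> all up-pointing triangles are present, and they are one
fewer than the down-pointing triangles that touch them. The latter have no other neighbours in
the strip, so exactly one of them is missing, that is, lies in \<open>V\<close>.\<close>

lemma strip_matching_imp_interlacing:
  fixes s :: "nat \<Rightarrow> int"
  assumes s: "strict_mono_on {..n} s" and S: "S = s ` {..n}" "S \<subseteq> {0..<l}"
    and V: "V \<subseteq> {0..<l - 1}" "card V = n"
    and \<mu>: "\<mu> \<in> strip_matchings k ({0..<l} - S) ({0..<l - 1} - V)"
  shows "\<exists>t \<in> interlacing n s. V = t ` {..<n}"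
proof -
  have one: "card (V \<inter> {s j..<s (Suc j)}) = 1" if j: "j < n" for j
  proof -
    have bounds: "0 \<le> s j" "s (Suc j) \<le> l - 1" "s j < s (Suc j)"
      using S(1) subsetD[OF S(2), of "s j"] subsetD[OF S(2), of "s (Suc j)"] j
        strict_mono_onD[OF s, of j "Suc j"] by auto
    have gap: "i \<notin> S" if "s j < i" "i < s (Suc j)" for i
    proof
      assume "i \<in> S"
      then obtain m where m: "m \<le> n" "i = s m" using S by auto
      then consider "m \<le> j" | "Suc j \<le> m" by linarith
      then show False
        using strict_mono_on_leD[OF s, of m j] strict_mono_on_leD[OF s, of "Suc j" m] m j that
        by cases auto
    qed
    have ends: "s j \<in> S" "s (Suc j) \<in> S" using S j by auto
    have "card ({s j<..<s (Suc j)} \<times> {k}) = card (({s j..<s (Suc j)} - V) \<times> {k + 1})"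
    proof (rule matching_card_restrict[OF \<mu>])
      show "{s j<..<s (Suc j)} \<times> {k} \<subseteq> ({0..<l} - S) \<times> {k}"
        using bounds gap by auto
      show "({s j..<s (Suc j)} - V) \<times> {k + 1} \<subseteq> ({0..<l - 1} - V) \<times> {k + 1}"
        using bounds by auto
    next
      fix p q assume pq: "(p, q) \<in> \<mu>"
      obtain i where i: "p = (i, k)" "i \<notin> S" using matchingsD(2)[OF \<mu> pq] by auto
      obtain i' where i': "q = (i', k + 1)" "i' \<notin> V" using matchingsD(3)[OF \<mu> pq] by auto
      have "i' = i \<or> i' = i - 1" using matchingsD(1)[OF \<mu> pq] i i' by (auto simp: adj_def)
      moreover have "i \<noteq> s j" "i \<noteq> s (Suc j)" using i ends by auto
      ultimately show "p \<in> {s j<..<s (Suc j)} \<times> {k} \<longleftrightarrow> q \<in> ({s j..<s (Suc j)} - V) \<times> {k + 1}"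
        using i i' by auto
    qed
    then have "nat (s (Suc j) - s j - 1) = card ({s j..<s (Suc j)} - V)"
      by (simp add: card_cartesian_product)
    also have "\<dots> = nat (s (Suc j) - s j) - card ({s j..<s (Suc j)} \<inter> V)"
      by (simp add: card_Diff_subset_Int)
    finally show ?thesis
      using bounds card_mono[of "{s j..<s (Suc j)}" "{s j..<s (Suc j)} \<inter> V"]
      by (simp add: Int_commute)
  qed
  define t where "t = (\<lambda>j\<in>{..<n}. the_elem (V \<inter> {s j..<s (Suc j)}))"
  have t: "t j \<in> V \<inter> {s j..<s (Suc j)}" if j: "j < n" for j
  proof -
    obtain v where "V \<inter> {s j..<s (Suc j)} = {v}"
      using one[OF j] by (rule card_1_singletonE)
    then show ?thesis using j by (simp add: t_def)
  qed
  then have box: "t \<in> interlacing n s"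
    by (auto simp: interlacing_def PiE_iff t_def)
  have "inj_on t {..<n}"
  proof (rule inj_onI)
    fix i j assume "i \<in> {..<n}" "j \<in> {..<n}" "t i = t j"
    then show "i = j" using t[of i] t[of j] gap_unique[OF s, of i j "t i"] by auto
  qed
  then have "card (t ` {..<n}) = card V" using V by (simp add: card_image)
  moreover have "t ` {..<n} \<subseteq> V" "finite V" using t V finite_subset by auto
  ultimately have "V = t ` {..<n}" using card_subset_eq by metis
  then show ?thesis using box by blast
qed

text \<open>In the gap between \<open>s j\<close> and \<open>s (j + 1)\<close> the triangles up to \<open>t j\<close> are paired with their left
neighbours and the others with their right neighbours, so that \<open>t j\<close> is left out. To the left of
all dents one has to pair rightwards, to the right of all dents leftwards.\<close>

lemma interlacing_imp_strip_matching:
  fixes s :: "nat \<Rightarrow> int"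
  assumes s: "strict_mono_on {..n} s" and S: "S = s ` {..n}" "S \<subseteq> {0..<l}"
    and t: "t \<in> interlacing n s" and V: "V = t ` {..<n}"
  shows "strip_matchings k ({0..<l} - S) ({0..<l - 1} - V) \<noteq> {}"
proof -
  have tD: "s j \<le> t j" "t j < s (Suc j)" if "j < n" for j
    using t that by (auto simp: interlacing_def PiE_iff)
  have sD: "0 \<le> s j" "s j < l" if "j \<le> n" for j
    using S(1) subsetD[OF S(2), of "s j"] that by auto
  have mono: "s i \<le> s j" if "i \<le> j" "j \<le> n" for i j
    using strict_mono_on_leD[OF s] that by auto
  define left where "left = (\<lambda>i. (\<exists>j<n. s j < i \<and> i \<le> t j) \<or> s n < i)"
  define \<phi> where "\<phi> = (\<lambda>i. if left i then i - 1 else i)"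
  let ?X = "{0..<l} - S" and ?Y = "{0..<l - 1} - V"
  have into: "\<phi> i \<in> ?Y" if "i \<in> ?X" for i
  proof (cases "left i")
    case True
    then consider j where "j < n" "s j < i" "i \<le> t j" | "s n < i" by (auto simp: left_def)
    then have "0 \<le> i - 1 \<and> i - 1 \<notin> V"
    proof cases
      case 1
      have "i - 1 \<noteq> t m" if m: "m < n" for m
      proof
        assume "i - 1 = t m"
        then have "m = j"
          using gap_unique[OF s, of m j "i - 1"] m 1 tD[OF m] tD[OF 1(1)] by auto
        then show False using \<open>i - 1 = t m\<close> 1 by auto
      qed
      then show ?thesis using V 1 sD[of j] by auto
    next
      case 2
      have "t m < s n" if "m < n" for m using tD[OF that] mono[of "Suc m" n] that by auto
      then show ?thesis using V 2 sD[of n] by fastforce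
    qed
    then show ?thesis using True that by (auto simp: \<phi>_def)
  next
    case False
    have "i \<noteq> l - 1"
      using False that sD[of n] S by (force simp: left_def)
    moreover have "i \<noteq> t j" if j: "j < n" for j
    proof
      assume "i = t j"
      moreover have "s j \<in> S" using S(1) j by simp
      ultimately have "s j < i" using tD(1)[OF j] \<open>i \<in> ?X\<close> by (metis Diff_iff order_less_le)
      then show False using False j \<open>i = t j\<close> by (auto simp: left_def)
    qed
    ultimately show ?thesis using False that V by (auto simp: \<phi>_def)
  qed
  \<comment> \<open>a rightward pair immediately followed by a leftward one would collide\<close>
  have succ: "left i" if "left (i + 1)" "i \<notin> S" for i
  proof -
    have ne: "i \<noteq> s j" if "j \<le> n" for j using \<open>i \<notin> S\<close> S(1) that by auto
    consider j where "j < n" "s j < i + 1" "i + 1 \<le> t j" | "s n < i + 1"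
      using \<open>left (i + 1)\<close> by (auto simp: left_def)
    then show ?thesis
    proof cases
      case 1
      then have "s j < i" "i \<le> t j" using ne[of j] by auto
      then show ?thesis using 1(1) by (auto simp: left_def)
    next
      case 2
      then have "s n < i" using ne[of n] by auto
      then show ?thesis by (simp add: left_def)
    qed
  qed
  have inj: "inj_on \<phi> ?X"
  proof (rule inj_onI)
    fix i i' assume i: "i \<in> ?X" "i' \<in> ?X" "\<phi> i = \<phi> i'"
    show "i = i'"
      using i succ[of i] succ[of i'] by (auto simp: \<phi>_def split: if_splits)
  qed
  have "inj_on s {..n}" using s by (rule strict_mono_on_imp_inj_on)
  then have "card S = n + 1" using S by (simp add: card_image)
  have "inj_on t {..<n}"
  proof (rule inj_onI)
    fix i j assume "i \<in> {..<n}" "j \<in> {..<n}" "t i = t j"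
    then show "i = j" using tD[of i] tD[of j] gap_unique[OF s, of i j "t i"] by auto
  qed
  then have "card V = n" using V by (simp add: card_image)
  have "V \<subseteq> {0..<l - 1}"
  proof
    fix v assume "v \<in> V"
    then obtain j where "j < n" "v = t j" using V by auto
    then show "v \<in> {0..<l - 1}" using tD[of j] sD[of j] sD[of "Suc j"] by auto
  qed
  then have "card ?X = card ?Y"
    using \<open>card S = n + 1\<close> \<open>card V = n\<close> S sD[of 0]
    by (subst (1 2) card_Diff_subset) (auto intro: finite_subset)
  \<comment> \<open>by cardinality, nothing in \<open>?Y\<close> is left uncovered\<close>
  then have surj: "\<phi> ` ?X = ?Y"
    using into inj by (intro card_subset_eq) (auto simp: card_image)
  have "(\<lambda>i. ((i, k), (\<phi> i, k + 1))) ` ?X \<in> strip_matchings k ?X ?Y"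
  proof (rule matchingsI, goal_cases)
    case (1 p q)
    then show ?case using into by (auto simp: adj_def \<phi>_def split: if_splits)
  next
    case (3 p p' q)
    then show ?case using inj by (auto dest: inj_onD)
  next
    case (5 q)
    then obtain a where q: "q = (a, k + 1)" "a \<in> ?Y" by auto
    then obtain i where "i \<in> ?X" "a = \<phi> i" using surj by blast
    then show ?case using q by blast
  qed auto
  then show ?thesis by blast
qed

lemma card_strip_matchings:
  fixes s :: "nat \<Rightarrow> int"
  assumes s: "strict_mono_on {..n} s" and S: "S = s ` {..n}" "S \<subseteq> {0..<l}"
    and V: "V \<subseteq> {0..<l - 1}" "card V = n"
  shows "card (strip_matchings k ({0..<l} - S) ({0..<l - 1} - V))
    = (if V \<in> (\<lambda>t. t ` {..<n}) ` interlacing n s then 1 else 0)"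
proof (cases "V \<in> (\<lambda>t. t ` {..<n}) ` interlacing n s")
  case True
  then obtain \<mu> where \<mu>: "\<mu> \<in> strip_matchings k ({0..<l} - S) ({0..<l - 1} - V)"
    using interlacing_imp_strip_matching[OF s S, of _ V k] by blast
  have "\<nu> = \<mu>" if "\<nu> \<in> strip_matchings k ({0..<l} - S) ({0..<l - 1} - V)" for \<nu>
    by (rule strip_matching_unique[OF that \<mu>]) auto
  then have "strip_matchings k ({0..<l} - S) ({0..<l - 1} - V) = {\<mu>}"
    using \<mu> by blast
  then show ?thesis using True by simp
next
  case False
  then have "strip_matchings k ({0..<l} - S) ({0..<l - 1} - V) = {}"
    using strip_matching_imp_interlacing[OF s S V, of _ k] by blast
  then show ?thesis using False by simp
qed

section \<open>Trapezoids with dents on the base\<close>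

lemma \<Delta>_image_eq_vandermonde:
  assumes s: "strict_mono_on {..<n} s"
  shows "\<Delta> (s ` {..<n}) = vandermonde n s"
proof -
  have inj: "inj_on s {..<n}" using s by (rule strict_mono_on_imp_inj_on)
  have less: "s i < s j \<longleftrightarrow> i < j" if "i < n" "j < n" for i j
    using that strict_mono_onD[OF s, of i j] strict_mono_onD[OF s, of j i]
    by (cases i j rule: linorder_cases) auto
  let ?I = "SIGMA j:{..<n}. {..<j}"
  let ?g = "\<lambda>(j, i). (s i, s j)"
  have "inj_on ?g ?I" using inj by (auto simp: inj_on_def)
  moreover have "?g ` ?I = {(p, q) \<in> s ` {..<n} \<times> s ` {..<n}. p < q}"
  proof (intro equalityI subsetI)
    fix x assume "x \<in> {(p, q) \<in> s ` {..<n} \<times> s ` {..<n}. p < q}"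
    then obtain i j where "i < n" "j < n" "x = (s i, s j)" "s i < s j" by auto
    then have "(j, i) \<in> ?I" "x = ?g (j, i)" using less by auto
    then show "x \<in> ?g ` ?I" by blast
  qed (auto simp: less)
  ultimately have "\<Delta> (s ` {..<n}) = (\<Prod>x\<in>?I. (case ?g x of (p, q) \<Rightarrow> q - p))"
    unfolding \<Delta>_def by (metis (no_types, lifting) prod.reindex_cong)
  also have "\<dots> = (\<Prod>(j, i)\<in>?I. s j - s i)" by (intro prod.cong) auto
  also have "\<dots> = vandermonde n s" unfolding vandermonde_def by (subst prod.Sigma) auto
  finally show ?thesis .
qed

text \<open>Indices of the up-pointing triangles in the trapezoid of height \<open>h\<close> whose base has length \<open>l\<close> and
left endpoint \<open>(0, k)\<close>. The height of the base is a parameter so that removing the lowest strip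
leaves a trapezoid of the same form.\<close>

definition trapezoid_up :: "int \<Rightarrow> int \<Rightarrow> nat \<Rightarrow> point set" where
  "trapezoid_up k l h = {(i, j). 0 \<le> i \<and> k \<le> j \<and> j < k + int h \<and> i + j < k + l}"

definition trapezoid_down :: "int \<Rightarrow> int \<Rightarrow> nat \<Rightarrow> point set" where
  "trapezoid_down k l h = {(i, j). 0 \<le> i \<and> k < j \<and> j \<le> k + int h \<and> i + j < k + l}"

lemma finite_trapezoid: "finite (trapezoid_up k l h)" "finite (trapezoid_down k l h)"
proof -
  have "trapezoid_up k l h \<subseteq> {0..<l} \<times> {k..k + int h}"
    "trapezoid_down k l h \<subseteq> {0..<l} \<times> {k..k + int h}"
    by (auto simp: trapezoid_up_def trapezoid_down_def)
  then show "finite (trapezoid_up k l h)" "finite (trapezoid_down k l h)"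
    using finite_subset by blast+
qed

abbreviation trapezoid_matchings :: "int \<Rightarrow> int \<Rightarrow> nat \<Rightarrow> int set \<Rightarrow> (point \<times> point) set set" where
  "trapezoid_matchings k l h S \<equiv> matchings (trapezoid_up k l h - S \<times> {k}) (trapezoid_down k l h)"

text \<open>The set \<open>\<beta>\<close> collects the columns in which the line must not be crossed.\<close>

lemma card_matchings_split:
  assumes "finite A" "finite E"
  shows "card {\<mu> \<in> matchings A E. \<forall>i\<in>\<beta>. ((i, k), (i, k)) \<notin> \<mu>}
    = (\<Sum>V\<in>Pow ({i. (i, k) \<in> A \<inter> E} - \<beta>). card (halves k A E V))"
proof -
  let ?J = "{i. (i, k) \<in> A \<inter> E}"
  have "?J \<subseteq> fst ` A" by force
  then have fin: "finite (Pow (?J - \<beta>))" using assms(1) finite_subset by blast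
  have fin': "finite (halves k A E V)" for V
    using assms unfolding halves_def by (auto intro!: finite_matchings)
  have "bij_betw (split_at_row k) {\<mu> \<in> matchings A E. \<forall>i\<in>\<beta>. ((i, k), (i, k)) \<notin> \<mu>}
      {x \<in> (SIGMA V : Pow ?J. halves k A E V). fst x \<inter> \<beta> = {}}"
    by (rule bij_betw_Collect[OF bij_betw_split_at_row]) (auto simp: split_at_row_def)
  moreover have "{x \<in> (SIGMA V : Pow ?J. halves k A E V). fst x \<inter> \<beta> = {}}
      = (SIGMA V : Pow (?J - \<beta>). halves k A E V)" by auto
  ultimately have "card {\<mu> \<in> matchings A E. \<forall>i\<in>\<beta>. ((i, k), (i, k)) \<notin> \<mu>}
      = card (SIGMA V : Pow (?J - \<beta>). halves k A E V)"
    by (simp only: bij_betw_same_card)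
  also have "\<dots> = (\<Sum>V\<in>Pow (?J - \<beta>). card (halves k A E V))"
    using fin fin' by (intro card_SigmaI) auto
  finally show ?thesis .
qed

text \<open>Cut along the first lattice line above the base. The lozenges crossing it take away up-pointing
triangles on the base of the smaller trapezoid, and are thus its dents. If \<open>h = 0\<close>, there are no
triangles above that line, which is why \<open>J\<close> is then empty.\<close>

lemma card_trapezoid_matchings_Suc:
  fixes k l :: int and h :: nat
  defines "J \<equiv> {i. 0 \<le> i \<and> i < l - 1 \<and> 0 < h}"
  assumes "S \<subseteq> {0..<l}"
  shows "card (trapezoid_matchings k l (Suc h) S)
    = (\<Sum>V\<in>Pow J. card (strip_matchings k ({0..<l} - S) ({0..<l - 1} - V))
        * card (trapezoid_matchings (k + 1) (l - 1) h V))"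
proof -
  let ?A = "trapezoid_up k l (Suc h) - S \<times> {k}" and ?E = "trapezoid_down k l (Suc h)"
  have J: "{i. (i, k + 1) \<in> ?A \<inter> ?E} = J"
    by (auto simp: J_def trapezoid_up_def trapezoid_down_def)
  have "halves (k + 1) ?A ?E V = strip_matchings k ({0..<l} - S) ({0..<l - 1} - V)
      \<times> trapezoid_matchings (k + 1) (l - 1) h V" for V
  proof -
    have "{p \<in> ?A. snd p < k + 1} = ({0..<l} - S) \<times> {k}"
      "{q \<in> ?E. snd q \<le> k + 1} - V \<times> {k + 1} = ({0..<l - 1} - V) \<times> {k + 1}"
      "{p \<in> ?A. snd p \<ge> k + 1} = trapezoid_up (k + 1) (l - 1) h"
      "{q \<in> ?E. snd q > k + 1} = trapezoid_down (k + 1) (l - 1) h"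
      by (auto simp: trapezoid_up_def trapezoid_down_def)
    then show ?thesis unfolding halves_def by simp
  qed
  then show ?thesis
    using card_matchings_split[of ?A ?E "{}" "k + 1"] finite_trapezoid unfolding J
    by (simp add: card_cartesian_product)
qed

text \<open>This is the formula of Cohn, Larsen and Propp. A set of dents of the wrong size leaves unequally many
triangles of the two kinds; such sets occur in the sums over all sets of crossing columns, so the
formula includes them. For \<open>h = 0\<close> the base carries no triangle that could be removed.\<close>

lemma trapezoid_count:
  assumes "int h \<le> l" "S \<subseteq> {0..<l}" "h = 0 \<Longrightarrow> S = {}"
  shows "(\<Prod>i<h. fact i) * int (card (trapezoid_matchings k l h S)) = (if card S = h then \<Delta> S else 0)"
  using assms
proof (induction h arbitrary: k l S)
  case 0
  have "matchings {} {} = {{}}" by (auto simp: matchings_def)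
  moreover have "trapezoid_up k l 0 = {}" "trapezoid_down k l 0 = {}"
    by (auto simp: trapezoid_up_def trapezoid_down_def)
  ultimately show ?case using 0 by (simp add: \<Delta>_def)
next
  case (Suc h)
  define J where "J = {i::int. 0 \<le> i \<and> i < l - 1 \<and> 0 < h}"
  have J: "J \<subseteq> {0..<l - 1}" "h = 0 \<Longrightarrow> J = {}" "finite J"
    by (auto simp: J_def intro: finite_subset[of _ "{0..<l - 1}"])
  let ?strip = "\<lambda>V. int (card (strip_matchings k ({0..<l} - S) ({0..<l - 1} - V)))"
  have "(\<Prod>i<Suc h. fact i) * int (card (trapezoid_matchings k l (Suc h) S))
      = fact h * (\<Sum>V\<in>Pow J. ?strip V *
          ((\<Prod>i<h. fact i) * int (card (trapezoid_matchings (k + 1) (l - 1) h V))))"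
    unfolding card_trapezoid_matchings_Suc[OF Suc.prems(2)] J_def[symmetric]
    by (simp add: sum_distrib_left mult_ac)
  also have "\<dots> = fact h * (\<Sum>V\<in>Pow J. ?strip V * (if card V = h then \<Delta> V else 0))"
  proof -
    have "(\<Prod>i<h. fact i) * int (card (trapezoid_matchings (k + 1) (l - 1) h V))
        = (if card V = h then \<Delta> V else 0)" if "V \<in> Pow J" for V
      using that J Suc.prems(1) by (intro Suc.IH) auto
    then show ?thesis by (intro arg_cong[where f = "\<lambda>x. fact h * x"] sum.cong refl) (simp only:)
  qed
  also have "\<dots> = (if card S = Suc h then \<Delta> S else 0)"
  proof (cases "card S = Suc h")
    case True
    have "finite S" using Suc.prems(2) finite_subset by blast
    define s where "s = (!) (sorted_list_of_set S)"
    have S: "S = s ` {..h}"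
      using set_sorted_list_of_set[OF \<open>finite S\<close>] True
      by (simp add: s_def set_conv_nth lessThan_Suc_atMost[symmetric]) blast
    have s: "strict_mono_on {..h} s"
    proof (rule strict_mono_onI)
      fix i j assume "i \<in> {..h}" "j \<in> {..h}" "i < j"
      then show "s i < s j"
        using sorted_wrt_nth_less[OF strict_sorted_list_of_set[of S], of i j] True by (simp add: s_def)
    qed
    have s_bounds: "0 \<le> s j" "s j < l" if "j \<le> h" for j
      using subsetD[OF Suc.prems(2), of "s j"] S that by auto
    let ?img = "(\<lambda>t. t ` {..<h}) ` interlacing h s"
    have t: "strict_mono_on {..<h} t" "t ` {..<h} \<subseteq> J" if "t \<in> interlacing h s" for t
    proof -
      have tD: "s j \<le> t j" "t j < s (Suc j)" if "j < h" for j
        using \<open>t \<in> interlacing h s\<close> that by (auto simp: interlacing_def PiE_iff)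
      show "strict_mono_on {..<h} t"
      proof (rule strict_mono_onI)
        fix i j assume "i \<in> {..<h}" "j \<in> {..<h}" "i < j"
        then show "t i < t j"
          using tD[of i] tD[of j] strict_mono_on_leD[OF s, of "Suc i" j] by auto
      qed
      show "t ` {..<h} \<subseteq> J"
      proof
        fix v assume "v \<in> t ` {..<h}"
        then obtain j where "j < h" "v = t j" by auto
        then show "v \<in> J" using tD[of j] s_bounds[of j] s_bounds[of "Suc j"] by (auto simp: J_def)
      qed
    qed
    have card_img: "card V = h" if "V \<in> ?img" for V
      using that t(1) by (auto simp: card_image strict_mono_on_imp_inj_on)
    have "(\<Sum>V\<in>Pow J. ?strip V * (if card V = h then \<Delta> V else 0))
        = (\<Sum>V\<in>Pow J. if V \<in> ?img then \<Delta> V else 0)"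
    proof (intro sum.cong refl)
      fix V assume "V \<in> Pow J"
      then have "V \<subseteq> {0..<l - 1}" using J(1) by auto
      then show "?strip V * (if card V = h then \<Delta> V else 0) = (if V \<in> ?img then \<Delta> V else 0)"
        using card_strip_matchings[OF s S Suc.prems(2), of V k] card_img[of V] by simp
    qed
    also have "\<dots> = (\<Sum>V\<in>Pow J \<inter> ?img. \<Delta> V)"
      using J(3) by (simp add: sum.inter_restrict)
    also have "Pow J \<inter> ?img = ?img" using t(2) by auto
    also have "(\<Sum>V\<in>?img. \<Delta> V) = (\<Sum>t\<in>interlacing h s. \<Delta> (t ` {..<h}))"
      using inj_on_interlacing_image[OF s] by (simp add: sum.reindex)
    also have "\<dots> = (\<Sum>t\<in>interlacing h s. vandermonde h t)"
      using t(1) by (simp add: \<Delta>_image_eq_vandermonde)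
    finally have "fact h * (\<Sum>V\<in>Pow J. ?strip V * (if card V = h then \<Delta> V else 0)) = vandermonde (Suc h) s"
      using sum_vandermonde_interlacing[of h s] strict_mono_on_leD[OF s] by (simp add: interlacing_def)
    also have "\<dots> = \<Delta> S"
      using \<Delta>_image_eq_vandermonde[of "Suc h" s] s S by (simp add: lessThan_Suc_atMost)
    finally show ?thesis using True by simp
  next
    case False
    \<comment> \<open>the full strip has one up-pointing triangle more than down-pointing ones, so that a
      matching forces \<open>card S = card V + 1\<close>\<close>
    have "?strip V = 0" if V: "V \<in> Pow J" "card V = h" for V
    proof (rule ccontr)
      assume "?strip V \<noteq> 0"
      then obtain \<mu> where \<mu>: "\<mu> \<in> strip_matchings k ({0..<l} - S) ({0..<l - 1} - V)"
        by (metis card.empty equals0I of_nat_0)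
      have V_sub: "V \<subseteq> {0..<l - 1}" using V(1) J(1) by auto
      have "card (({0..<l} - S) \<times> {k}) = card (({0..<l - 1} - V) \<times> {k + 1})"
        using matchingsD(2,3)[OF \<mu>] by (intro matching_card_restrict[OF \<mu>]) auto
      then have "card {0..<l} - card S = card {0..<l - 1} - card V"
        using Suc.prems(2) V_sub by (simp add: card_cartesian_product card_Diff_subset finite_subset)
      moreover have "card S \<le> card {0..<l}" "card V \<le> card {0..<l - 1}"
        using Suc.prems(2) V_sub by (intro card_mono; simp)+
      ultimately show False using False V(2) Suc.prems(1) by auto
    qed
    then have "(\<Sum>V\<in>Pow J. ?strip V * (if card V = h then \<Delta> V else 0)) = 0"
      by (intro sum.neutral) auto
    then show ?thesis using False by simp
  qed
  finally show ?case .
qed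

section \<open>Lozenge tilings as matchings\<close>

text \<open>The coordinate sums over the vertices recover the index of a triangle, and modulo 3 its
orientation.\<close>

lemma sum_up_triangle: "(\<Sum>x\<in>up_triangle (i, j). fst x) = 3 * i + 1" "(\<Sum>x\<in>up_triangle (i, j). snd x) = 3 * j + 1"
  by (simp_all add: up_triangle_def)

lemma sum_down_triangle:
  "(\<Sum>x\<in>down_triangle (i, j). fst x) = 3 * i + 2" "(\<Sum>x\<in>down_triangle (i, j). snd x) = 3 * j - 1"
  by (simp_all add: down_triangle_def)

lemma up_triangle_eq_iff [simp]: "up_triangle p = up_triangle q \<longleftrightarrow> p = q"
proof (cases p; cases q)
  fix i j i' j' assume "p = (i, j)" "q = (i', j')"
  then show ?thesis
    using sum_up_triangle[of i j] sum_up_triangle[of i' j'] by auto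
qed

lemma down_triangle_eq_iff [simp]: "down_triangle p = down_triangle q \<longleftrightarrow> p = q"
proof (cases p; cases q)
  fix i j i' j' assume "p = (i, j)" "q = (i', j')"
  then show ?thesis
    using sum_down_triangle[of i j] sum_down_triangle[of i' j'] by auto
qed

lemma up_neq_down [simp]: "up_triangle p \<noteq> down_triangle q" "down_triangle q \<noteq> up_triangle p"
proof -
  obtain i j i' j' where "p = (i, j)" "q = (i', j')" by (cases p; cases q)
  moreover have "3 * i + 1 \<noteq> 3 * i' + 2" by presburger
  ultimately have "up_triangle p \<noteq> down_triangle q"
    using sum_up_triangle(1)[of i j] sum_down_triangle(1)[of i' j'] by auto
  then show "up_triangle p \<noteq> down_triangle q" "down_triangle q \<noteq> up_triangle p" by auto
qed

lemma card_2_two_elements: "card X = 2 \<Longrightarrow> \<exists>a b. a \<noteq> b \<and> a \<in> X \<and> b \<in> X"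
  by (auto simp: card_2_iff)

lemma card_up_Int_down: "card (up_triangle p \<inter> down_triangle q) = 2 \<longleftrightarrow> adj p q"
proof
  assume "adj p q"
  then show "card (up_triangle p \<inter> down_triangle q) = 2"
  proof -
    obtain i j where p: "p = (i, j)" by (cases p)
    consider "q = (i, j)" | "q = (i - 1, j + 1)" | "q = (i, j + 1)"
      using \<open>adj p q\<close> p by (auto simp: adj_def)
    then show ?thesis
    proof cases
      case 1
      then have "up_triangle p \<inter> down_triangle q = {(i, j), (i + 1, j)}"
        unfolding p by (auto simp: up_triangle_def down_triangle_def)
      then show ?thesis by simp
    next
      case 2
      then have "up_triangle p \<inter> down_triangle q = {(i, j), (i, j + 1)}"
        unfolding p by (auto simp: up_triangle_def down_triangle_def)
      then show ?thesis by simp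
    next
      case 3
      then have "up_triangle p \<inter> down_triangle q = {(i + 1, j), (i, j + 1)}"
        unfolding p by (auto simp: up_triangle_def down_triangle_def)
      then show ?thesis by simp
    qed
  qed
next
  assume "card (up_triangle p \<inter> down_triangle q) = 2"
  then obtain a b where ab: "a \<noteq> b" "a \<in> up_triangle p" "a \<in> down_triangle q"
      "b \<in> up_triangle p" "b \<in> down_triangle q"
    using card_2_two_elements by blast
  obtain i j where p: "p = (i, j)" by (cases p)
  obtain i' j' where q: "q = (i', j')" by (cases q)
  show "adj p q"
    using ab unfolding p q by (auto simp: adj_def up_triangle_def down_triangle_def)
qed

lemma card_up_Int_up: "card (up_triangle p \<inter> up_triangle q) \<noteq> 2"
proof
  assume c: "card (up_triangle p \<inter> up_triangle q) = 2"
  then obtain a b where ab: "a \<noteq> b" "a \<in> up_triangle p" "a \<in> up_triangle q"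
      "b \<in> up_triangle p" "b \<in> up_triangle q"
    using card_2_two_elements by blast
  obtain i j where p: "p = (i, j)" by (cases p)
  obtain i' j' where q: "q = (i', j')" by (cases q)
  have "p = q"
    using ab unfolding p q by (auto simp: up_triangle_def)
  then have "card (up_triangle (i, j)) = 2" using c p by simp
  then show False by (simp add: up_triangle_def)
qed

lemma card_down_Int_down: "card (down_triangle p \<inter> down_triangle q) \<noteq> 2"
proof
  assume c: "card (down_triangle p \<inter> down_triangle q) = 2"
  then obtain a b where ab: "a \<noteq> b" "a \<in> down_triangle p" "a \<in> down_triangle q"
      "b \<in> down_triangle p" "b \<in> down_triangle q"
    using card_2_two_elements by blast
  obtain i j where p: "p = (i, j)" by (cases p)
  obtain i' j' where q: "q = (i', j')" by (cases q)
  have "p = q"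
    using ab unfolding p q by (auto simp: down_triangle_def)
  then have "card (down_triangle (i, j)) = 2" using c p by simp
  then show False by (simp add: down_triangle_def)
qed

definition lozenge_of :: "point \<times> point \<Rightarrow> lozenge" where
  "lozenge_of = (\<lambda>(p, q). {up_triangle p, down_triangle q})"

lemma lozenge_of_eq_iff [simp]: "lozenge_of e = lozenge_of e' \<longleftrightarrow> e = e'"
  by (cases e; cases e') (auto simp: lozenge_of_def doubleton_eq_iff)

lemma inj_lozenge_of: "inj lozenge_of"
  by (simp add: inj_on_def)

lemma is_lozenge_iff: "is_lozenge L \<longleftrightarrow> (\<exists>p q. adj p q \<and> L = lozenge_of (p, q))"
proof
  assume "is_lozenge L"
  then obtain s t where st: "s \<in> unit_triangles" "t \<in> unit_triangles" "card (s \<inter> t) = 2" "L = {s, t}"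
    by (auto simp: is_lozenge_def)
  then consider p q where "s = up_triangle p" "t = up_triangle q"
    | p q where "s = up_triangle p" "t = down_triangle q"
    | p q where "t = up_triangle p" "s = down_triangle q"
    | p q where "s = down_triangle p" "t = down_triangle q"
    unfolding unit_triangles_def by blast
  then show "\<exists>p q. adj p q \<and> L = lozenge_of (p, q)"
  proof cases
    case 1
    then show ?thesis using st(3) card_up_Int_up by simp
  next
    case 2
    then have "adj p q" using st(3) card_up_Int_down[of p q] by simp
    moreover have "L = lozenge_of (p, q)" using 2 st(4) by (auto simp: lozenge_of_def)
    ultimately show ?thesis by blast
  next
    case 3
    then have "adj p q" using st(3) card_up_Int_down[of p q] by (simp add: Int_commute)
    moreover have "L = lozenge_of (p, q)" using 3 st(4) by (auto simp: lozenge_of_def)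
    ultimately show ?thesis by blast
  next
    case 4
    then show ?thesis using st(3) card_down_Int_down by simp
  qed
next
  assume "\<exists>p q. adj p q \<and> L = lozenge_of (p, q)"
  then obtain p q where "adj p q" "L = {up_triangle p, down_triangle q}" by (auto simp: lozenge_of_def)
  then show "is_lozenge L"
    unfolding is_lozenge_def using card_up_Int_down
    by (intro bexI[of _ "up_triangle p"] bexI[of _ "down_triangle q"]) (auto simp: unit_triangles_def)
qed

definition region_of :: "point set \<Rightarrow> point set \<Rightarrow> region" where
  "region_of A E = up_triangle ` A \<union> down_triangle ` E"

lemma in_region_of [simp]:
  "up_triangle p \<in> region_of A E \<longleftrightarrow> p \<in> A" "down_triangle q \<in> region_of A E \<longleftrightarrow> q \<in> E"
  by (auto simp: region_of_def)

text \<open>Edge-sharing triangles have opposite orientations, so every lozenge is a pair of adjacent indices;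
disjointness and covering say that each triangle has exactly one partner.\<close>

lemma is_tiling_iff: "is_tiling (region_of A E) T \<longleftrightarrow> T \<in> (`) lozenge_of ` matchings A E"
proof
  assume T: "is_tiling (region_of A E) T"
  then have un: "\<Union>T = region_of A E" and dis: "\<And>L L'. L \<in> T \<Longrightarrow> L' \<in> T \<Longrightarrow> L \<inter> L' \<noteq> {} \<Longrightarrow> L = L'"
    and loz: "\<And>L. L \<in> T \<Longrightarrow> \<exists>p q. adj p q \<and> L = lozenge_of (p, q)"
    by (auto simp: is_tiling_def partition_on_def disjoint_def is_lozenge_iff)
  define \<mu> where "\<mu> = {e. lozenge_of e \<in> T}"
  have T_eq: "T = lozenge_of ` \<mu>" using loz by (auto simp: \<mu>_def)
  have "\<mu> \<in> matchings A E"
  proof (rule matchingsI, goal_cases)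
    case (1 p q)
    then have L: "lozenge_of (p, q) \<in> T" by (simp add: \<mu>_def)
    then obtain p' q' where "adj p' q'" "lozenge_of (p, q) = lozenge_of (p', q')" using loz by blast
    moreover have "up_triangle p \<in> \<Union>T" "down_triangle q \<in> \<Union>T"
      using L by (auto simp: lozenge_of_def)
    ultimately show ?case by (simp add: un)
  next
    case (2 p q q')
    then have "lozenge_of (p, q) = lozenge_of (p, q')"
      by (intro dis) (auto simp: \<mu>_def lozenge_of_def)
    then show ?case by simp
  next
    case (3 p p' q)
    then have "lozenge_of (p, q) = lozenge_of (p', q)"
      by (intro dis) (auto simp: \<mu>_def lozenge_of_def)
    then show ?case by simp
  next
    case (4 p)
    then have "up_triangle p \<in> \<Union>T" by (simp add: un)
    then obtain e where "e \<in> \<mu>" "up_triangle p \<in> lozenge_of e" unfolding T_eq by blast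
    then have "e \<in> \<mu> \<and> fst e = p" by (cases e) (auto simp: lozenge_of_def)
    then show ?case by (metis prod.collapse)
  next
    case (5 q)
    then have "down_triangle q \<in> \<Union>T" by (simp add: un)
    then obtain e where "e \<in> \<mu>" "down_triangle q \<in> lozenge_of e" unfolding T_eq by blast
    then have "e \<in> \<mu> \<and> snd e = q" by (cases e) (auto simp: lozenge_of_def)
    then show ?case by (metis prod.collapse)
  qed
  then show "T \<in> (`) lozenge_of ` matchings A E" using T_eq by blast
next
  assume "T \<in> (`) lozenge_of ` matchings A E"
  then obtain \<mu> where \<mu>: "\<mu> \<in> matchings A E" and T: "T = lozenge_of ` \<mu>" by blast
  note D = matchingsD[OF \<mu>]
  have "\<Union>T = region_of A E"
  proof (intro equalityI subsetI)
    fix t assume "t \<in> \<Union>T"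
    then show "t \<in> region_of A E" using D(2,3) by (auto simp: T lozenge_of_def)
  next
    fix t assume "t \<in> region_of A E"
    then consider p where "p \<in> A" "t = up_triangle p" | q where "q \<in> E" "t = down_triangle q"
      by (auto simp: region_of_def)
    then show "t \<in> \<Union>T"
    proof cases
      case 1
      then obtain q where "(p, q) \<in> \<mu>" using D(6) by blast
      then have "lozenge_of (p, q) \<in> T" unfolding T by blast
      moreover have "t \<in> lozenge_of (p, q)" using 1 by (simp add: lozenge_of_def)
      ultimately show ?thesis by blast
    next
      case 2
      then obtain p where "(p, q) \<in> \<mu>" using D(7) by blast
      then have "lozenge_of (p, q) \<in> T" unfolding T by blast
      moreover have "t \<in> lozenge_of (p, q)" using 2 by (simp add: lozenge_of_def)
      ultimately show ?thesis by blast
    qed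
  qed
  moreover have "disjoint T"
  proof (rule disjointI)
    fix L L' assume "L \<in> T" "L' \<in> T" "L \<noteq> L'"
    moreover have "\<exists>p q. (p, q) \<in> \<mu> \<and> K = lozenge_of (p, q)" if "K \<in> T" for K
      using that unfolding T by (metis imageE surj_pair)
    ultimately obtain p q p' q' where e: "(p, q) \<in> \<mu>" "L = lozenge_of (p, q)"
        "(p', q') \<in> \<mu>" "L' = lozenge_of (p', q')"
      by meson
    have "p \<noteq> p'" "q \<noteq> q'"
      using D(4)[of p q q'] D(5)[of p q p'] \<open>L \<noteq> L'\<close> e by blast+
    then show "L \<inter> L' = {}" unfolding e(2,4) lozenge_of_def by simp
  qed
  moreover have "{} \<notin> T" unfolding T by (auto simp: lozenge_of_def)
  moreover have "is_lozenge L" if "L \<in> T" for L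
    using that D(1) unfolding T is_lozenge_iff by auto
  ultimately show "is_tiling (region_of A E) T" by (simp add: is_tiling_def partition_on_def)
qed

lemma half_turn_up: "half_turn l ` up_triangle p = down_triangle (turn l p)"
  by (cases p) (auto simp: half_turn_def up_triangle_def down_triangle_def turn_def)

lemma half_turn_down: "half_turn l ` down_triangle p = up_triangle (turn l p)"
  by (cases p) (auto simp: half_turn_def up_triangle_def down_triangle_def turn_def)

lemma centrally_symmetric_iff:
  "centrally_symmetric l (lozenge_of ` \<mu>) \<longleftrightarrow> turn_matching l \<mu> = \<mu>"
proof -
  have "(\<lambda>t. half_turn l ` t) ` lozenge_of e = lozenge_of (case e of (p, q) \<Rightarrow> (turn l q, turn l p))" for e
    by (cases e) (simp add: lozenge_of_def half_turn_up half_turn_down insert_commute)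
  then have "(\<lambda>L. (\<lambda>t. half_turn l ` t) ` L) ` (lozenge_of ` \<mu>) = lozenge_of ` turn_matching l \<mu>"
    unfolding turn_matching_def image_image by simp
  then show ?thesis
    unfolding centrally_symmetric_def using inj_image_eq_iff[OF inj_lozenge_of] by metis
qed

text \<open>Indices of the up-pointing triangles in the hexagon with axis of length \<open>l\<close> and height \<open>h\<close> on both
sides of the axis.\<close>

definition hexagon_up :: "int \<Rightarrow> nat \<Rightarrow> point set" where
  "hexagon_up l h = {(i, j). 0 \<le> i \<and> i < l \<and> - int h \<le> j \<and> j < int h \<and> 0 \<le> i + j \<and> i + j < l}"

definition hexagon_down :: "int \<Rightarrow> nat \<Rightarrow> point set" where
  "hexagon_down l h = {(i, j). 0 \<le> i \<and> i < l \<and> - int h < j \<and> j \<le> int h \<and> 0 \<le> i + j \<and> i + j < l}"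

lemma hexagon_eq: "hexagon (l - int h) (int h) (int h) = region_of (hexagon_up l h) (hexagon_down l h)"
proof -
  have "up_triangle p \<subseteq> hexagon_points (l - int h) (int h) (int h) \<longleftrightarrow> p \<in> hexagon_up l h" for p
    by (cases p) (auto simp: up_triangle_def hexagon_points_def hexagon_up_def)
  moreover have "down_triangle p \<subseteq> hexagon_points (l - int h) (int h) (int h) \<longleftrightarrow> p \<in> hexagon_down l h" for p
    by (cases p) (auto simp: down_triangle_def hexagon_points_def hexagon_down_def)
  ultimately show ?thesis
    unfolding hexagon_def unit_triangles_def region_of_def by blast
qed

lemma region_of_Diff:
  "region_of A E - (up_triangle ` X \<union> down_triangle ` Y) = region_of (A - X) (E - Y)"
  unfolding region_of_def by auto

abbreviation hexagon_matchings :: "int \<Rightarrow> nat \<Rightarrow> int set \<Rightarrow> (point \<times> point) set set" where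
  "hexagon_matchings l h P \<equiv>
    matchings (hexagon_up l h - P \<times> {0}) (hexagon_down l h - reflect (l - 1) P \<times> {0})"

text \<open>The segment at position \<open>w\<close> has the left endpoint \<open>(w - 1, 0)\<close>.\<close>

definition column :: "int \<Rightarrow> int" where
  "column w = w - 1"

text \<open>The passage from positions to columns turns the mirror image of positions, whose sums are \<open>l + 1\<close>,
into the mirror image of columns, whose sums are \<open>l - 1\<close>.\<close>

lemma CS_region_eq:
  assumes l: "l = axis_length x y U D" and h: "h = y + card U + card D"
    and P: "P = column ` (U \<union> reflect (l + 1) D)"
  shows "CS_region x y U D
    = region_of (hexagon_up l h - P \<times> {0}) (hexagon_down l h - reflect (l - 1) P \<times> {0})"
proof -
  have "column ` (D \<union> reflect (l + 1) U) = reflect (l - 1) P"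
    unfolding P by (simp add: reflect_def image_Un image_image column_def Un_commute)
  moreover have "up_at ` W = up_triangle ` (column ` W \<times> {0})"
    "down_at ` W = down_triangle ` (column ` W \<times> {0})" for W
    by (auto simp: up_at_def down_at_def column_def image_iff)
  moreover have "int x + 2 * int (card (U \<union> D)) - int (card U) - int (card D) = l - int h"
    "int y + int (card U) + int (card D) = int h"
    by (simp_all add: l h axis_length_def)
  ultimately show ?thesis
    unfolding CS_region_def Let_def l[symmetric] by (simp add: hexagon_eq region_of_Diff P)
qed

lemma CS_tilings_eq:
  assumes l: "l = axis_length x y U D" and h: "h = y + card U + card D"
    and P: "P = column ` (U \<union> reflect (l + 1) D)" and \<beta>: "\<beta> = column ` (B \<union> reflect (l + 1) B)"
  shows "CS_tilings x y U D B
    = (`) lozenge_of ` {\<mu> \<in> hexagon_matchings l h P. \<forall>i\<in>\<beta>. ((i, 0), (i, 0)) \<notin> \<mu>}"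
proof -
  have "{up_at i, down_at i} = lozenge_of ((column i, 0), (column i, 0))" for i
    by (simp add: lozenge_of_def up_at_def down_at_def column_def)
  then have "(\<forall>i\<in>B \<union> reflect (l + 1) B. {up_at i, down_at i} \<notin> lozenge_of ` \<mu>)
      \<longleftrightarrow> (\<forall>i\<in>\<beta>. ((i, 0), (i, 0)) \<notin> \<mu>)" for \<mu>
    unfolding \<beta> by (simp add: inj_image_mem_iff[OF inj_lozenge_of])
  then show ?thesis
    unfolding CS_tilings_def l[symmetric] CS_region_eq[OF l h P] is_tiling_iff by auto
qed

lemma inj_on_image_lozenge_of: "inj_on ((`) lozenge_of) X"
  using inj_lozenge_of by (meson inj_image_eq_iff inj_onI)

lemma M_eq_card:
  assumes l: "l = axis_length x y U D" and h: "h = y + card U + card D"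
    and P: "P = column ` (U \<union> reflect (l + 1) D)" and \<beta>: "\<beta> = column ` (B \<union> reflect (l + 1) B)"
  shows "M x y U D B = card {\<mu> \<in> hexagon_matchings l h P. \<forall>i\<in>\<beta>. ((i, 0), (i, 0)) \<notin> \<mu>}"
    and "M\<^sub>c x y U D B = card {\<mu> \<in> hexagon_matchings l h P.
      (\<forall>i\<in>\<beta>. ((i, 0), (i, 0)) \<notin> \<mu>) \<and> turn_matching l \<mu> = \<mu>}"
proof -
  let ?X = "{\<mu> \<in> hexagon_matchings l h P. \<forall>i\<in>\<beta>. ((i, 0), (i, 0)) \<notin> \<mu>}"
  have T: "CS_tilings x y U D B = (`) lozenge_of ` ?X" by (rule CS_tilings_eq[OF l h P \<beta>])
  show "M x y U D B = card ?X"
    unfolding M_def T by (rule card_image[OF inj_on_image_lozenge_of])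
  have "{T \<in> CS_tilings x y U D B. centrally_symmetric (axis_length x y U D) T}
      = (`) lozenge_of ` {\<mu> \<in> ?X. turn_matching l \<mu> = \<mu>}"
    unfolding T l[symmetric] using centrally_symmetric_iff[of l] by blast
  then have "M\<^sub>c x y U D B = card {\<mu> \<in> ?X. turn_matching l \<mu> = \<mu>}"
    unfolding M\<^sub>c_def using card_image[OF inj_on_image_lozenge_of] by simp
  then show "M\<^sub>c x y U D B = card {\<mu> \<in> hexagon_matchings l h P.
      (\<forall>i\<in>\<beta>. ((i, 0), (i, 0)) \<notin> \<mu>) \<and> turn_matching l \<mu> = \<mu>}"
    by (simp add: conj_assoc)
qed

section \<open>Cutting the hexagon along its axis\<close>

lemma in_reflect [simp]: "i \<in> reflect m W \<longleftrightarrow> m - i \<in> W"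
  by (auto simp: reflect_def intro: rev_image_eqI[where x = "m - i"])

lemma reflect_reflect [simp]: "reflect m (reflect m W) = W"
  by auto

text \<open>The half-turn carries the lower half of the hexagon to the upper half. The triangles missing below
the axis are those at the mirror image of \<open>P\<close> and at \<open>V\<close>, hence those at \<open>P\<close> and the mirror image
of \<open>V\<close> after the turn.\<close>

lemma hexagon_halves:
  fixes l :: int and h :: nat and P V :: "int set"
  defines "A \<equiv> hexagon_up l h - P \<times> {0}" and "E \<equiv> hexagon_down l h - reflect (l - 1) P \<times> {0}"
  shows "halves 0 A E V
    = turn_matching l ` trapezoid_matchings 0 l h (P \<union> reflect (l - 1) V) \<times> trapezoid_matchings 0 l h (P \<union> V)"
proof -
  have "{p \<in> A. snd p < 0} = turn l ` trapezoid_down 0 l h"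
  proof (rule Set.set_eqI)
    show "p \<in> {p \<in> A. snd p < 0} \<longleftrightarrow> p \<in> turn l ` trapezoid_down 0 l h" for p
      unfolding in_turn_image by (cases p) (auto simp: A_def turn_def hexagon_up_def trapezoid_down_def)
  qed
  moreover have "{q \<in> E. snd q \<le> 0} - V \<times> {0}
      = turn l ` (trapezoid_up 0 l h - (P \<union> reflect (l - 1) V) \<times> {0})"
  proof (rule Set.set_eqI)
    show "p \<in> {q \<in> E. snd q \<le> 0} - V \<times> {0}
        \<longleftrightarrow> p \<in> turn l ` (trapezoid_up 0 l h - (P \<union> reflect (l - 1) V) \<times> {0})" for p
      unfolding in_turn_image by (cases p) (auto simp: E_def turn_def hexagon_down_def trapezoid_up_def)
  qed
  moreover have "{p \<in> A. snd p \<ge> 0} - V \<times> {0} = trapezoid_up 0 l h - (P \<union> V) \<times> {0}"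
    "{q \<in> E. snd q > 0} = trapezoid_down 0 l h"
    by (auto simp: A_def E_def hexagon_up_def hexagon_down_def trapezoid_up_def trapezoid_down_def)
  ultimately have "halves 0 A E V = matchings (turn l ` trapezoid_down 0 l h)
      (turn l ` (trapezoid_up 0 l h - (P \<union> reflect (l - 1) V) \<times> {0})) \<times> trapezoid_matchings 0 l h (P \<union> V)"
    by (simp only: halves_def)
  then show ?thesis
    using bij_betw_imp_surj_on[OF bij_betw_turn_matching] by metis
qed

lemma finite_hexagon: "finite (hexagon_up l h)" "finite (hexagon_down l h)"
proof -
  have "hexagon_up l h \<subseteq> {0..<l} \<times> {- int h..int h}" "hexagon_down l h \<subseteq> {0..<l} \<times> {- int h..int h}"
    by (auto simp: hexagon_up_def hexagon_down_def)
  then show "finite (hexagon_up l h)" "finite (hexagon_down l h)"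
    using finite_subset by blast+
qed

text \<open>A hexagon of height 0 has no triangles at all, so nothing can cross its axis.\<close>

definition crossing_columns :: "int \<Rightarrow> nat \<Rightarrow> int set \<Rightarrow> int set" where
  "crossing_columns l h X = {i. 0 \<le> i \<and> i < l \<and> 0 < h} - X"

lemma finite_crossing_columns [simp]: "finite (crossing_columns l h X)"
  by (rule finite_subset[of _ "{0..<l}"]) (auto simp: crossing_columns_def)

lemma crossing_columns_eq:
  "{i. (i, 0) \<in> (hexagon_up l h - P \<times> {0}) \<inter> (hexagon_down l h - reflect (l - 1) P \<times> {0})} - \<beta>
    = crossing_columns l h (P \<union> reflect (l - 1) P \<union> \<beta>)"
  by (auto simp: crossing_columns_def hexagon_up_def hexagon_down_def)

lemma inj_turn_matching: "inj_on (turn_matching l) X"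
  by (metis inj_onI turn_matching_turn_matching)

text \<open>Each half of the hexagon is a trapezoid, the lower one after a half-turn; the two are tiled
independently once the crossing columns \<open>V\<close> are chosen.\<close>

lemma hexagon_count:
  "card {\<mu> \<in> hexagon_matchings l h P. \<forall>i\<in>\<beta>. ((i, 0), (i, 0)) \<notin> \<mu>}
    = (\<Sum>V\<in>Pow (crossing_columns l h (P \<union> reflect (l - 1) P \<union> \<beta>)).
        card (trapezoid_matchings 0 l h (P \<union> V))
          * card (trapezoid_matchings 0 l h (P \<union> reflect (l - 1) V)))"
  unfolding card_matchings_split[OF finite_Diff[OF finite_hexagon(1)] finite_Diff[OF finite_hexagon(2)]]
    crossing_columns_eq hexagon_halves card_cartesian_product card_image[OF inj_turn_matching]
  by (simp add: mult.commute)

text \<open>The half-turn exchanges the two sides of the axis and mirrors the crossing columns.\<close>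

lemma turn_matching_eq_self_iff:
  assumes \<mu>: "\<mu> \<in> matchings A E" and c: "split_at_row 0 \<mu> = (V, \<mu>\<^sub>1, \<mu>\<^sub>2)"
  shows "turn_matching l \<mu> = \<mu> \<longleftrightarrow> reflect (l - 1) V = V \<and> \<mu>\<^sub>1 = turn_matching l \<mu>\<^sub>2"
proof
  assume sym: "turn_matching l \<mu> = \<mu>"
  then have e: "(turn l q, turn l p) \<in> \<mu> \<longleftrightarrow> (p, q) \<in> \<mu>" for p q
    using in_turn_matching by metis
  have "i \<in> reflect (l - 1) V \<longleftrightarrow> i \<in> V" for i
    using e[of "(i, 0)" "(i, 0)"] c by (auto simp: split_at_row_def turn_def)
  moreover have "(p, q) \<in> \<mu>\<^sub>1 \<longleftrightarrow> (p, q) \<in> turn_matching l \<mu>\<^sub>2" for p q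
    using e[where p = p and q = q] c by (cases p; cases q) (auto simp: in_turn_matching split_at_row_def turn_def)
  ultimately show "reflect (l - 1) V = V \<and> \<mu>\<^sub>1 = turn_matching l \<mu>\<^sub>2" by auto
next
  assume a: "reflect (l - 1) V = V \<and> \<mu>\<^sub>1 = turn_matching l \<mu>\<^sub>2"
  then have V: "l - 1 - i \<in> V \<longleftrightarrow> i \<in> V" for i using in_reflect[of i "l - 1" V] by simp
  have \<mu>_eq: "\<mu> = (\<lambda>i. ((i, 0), (i, 0))) ` V \<union> turn_matching l \<mu>\<^sub>2 \<union> \<mu>\<^sub>2"
    using join_split_at_row[OF \<mu>, of 0] c a by (simp add: join_at_row_def)
  have diag: "(p, q) \<in> (\<lambda>i. ((i, 0), (i, 0))) ` V \<longleftrightarrow> q = p \<and> snd p = 0 \<and> fst p \<in> V" for p q :: point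
    by (cases p; cases q) auto
  have "(turn l q, turn l p) \<in> \<mu> \<longleftrightarrow> (p, q) \<in> \<mu>" for p q
    unfolding \<mu>_eq Un_iff diag in_turn_matching
    by (cases p; cases q) (auto simp: V turn_def)
  then show "turn_matching l \<mu> = \<mu>" using in_turn_matching by auto
qed

text \<open>A symmetric tiling is determined by its upper half, and any tiling of the upper half can be
completed by its image under the half-turn as soon as the crossing columns are mirror symmetric.\<close>

lemma hexagon_count_symmetric:
  "card {\<mu> \<in> hexagon_matchings l h P. (\<forall>i\<in>\<beta>. ((i, 0), (i, 0)) \<notin> \<mu>) \<and> turn_matching l \<mu> = \<mu>}
    = (\<Sum>V\<in>{V \<in> Pow (crossing_columns l h (P \<union> reflect (l - 1) P \<union> \<beta>)). reflect (l - 1) V = V}.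
        card (trapezoid_matchings 0 l h (P \<union> V)))"
proof -
  let ?A = "hexagon_up l h - P \<times> {0}" and ?E = "hexagon_down l h - reflect (l - 1) P \<times> {0}"
  let ?J = "{i. (i, 0) \<in> ?A \<inter> ?E}"
  let ?\<V> = "{V \<in> Pow (crossing_columns l h (P \<union> reflect (l - 1) P \<union> \<beta>)). reflect (l - 1) V = V}"
  have bij: "bij_betw (split_at_row 0)
      {\<mu> \<in> matchings ?A ?E. (\<forall>i\<in>\<beta>. ((i, 0), (i, 0)) \<notin> \<mu>) \<and> turn_matching l \<mu> = \<mu>}
      {x \<in> (SIGMA V : Pow ?J. halves 0 ?A ?E V). fst x \<inter> \<beta> = {} \<and> reflect (l - 1) (fst x) = fst x
         \<and> fst (snd x) = turn_matching l (snd (snd x))}"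
  proof (rule bij_betw_Collect[OF bij_betw_split_at_row])
    fix \<mu> assume \<mu>: "\<mu> \<in> matchings ?A ?E"
    obtain V \<mu>\<^sub>1 \<mu>\<^sub>2 where c: "split_at_row 0 \<mu> = (V, \<mu>\<^sub>1, \<mu>\<^sub>2)" by (cases "split_at_row 0 \<mu>")
    then have "(\<forall>i\<in>\<beta>. ((i, 0), (i, 0)) \<notin> \<mu>) \<longleftrightarrow> V \<inter> \<beta> = {}" by (auto simp: split_at_row_def)
    then show "(fst (split_at_row 0 \<mu>) \<inter> \<beta> = {} \<and> reflect (l - 1) (fst (split_at_row 0 \<mu>)) = fst (split_at_row 0 \<mu>)
         \<and> fst (snd (split_at_row 0 \<mu>)) = turn_matching l (snd (snd (split_at_row 0 \<mu>)))) \<longleftrightarrow>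
      ((\<forall>i\<in>\<beta>. ((i, 0), (i, 0)) \<notin> \<mu>) \<and> turn_matching l \<mu> = \<mu>)"
      using turn_matching_eq_self_iff[OF \<mu> c] c by simp
  qed
  have LR: "{x \<in> (SIGMA V : Pow ?J. halves 0 ?A ?E V). fst x \<inter> \<beta> = {} \<and> reflect (l - 1) (fst x) = fst x
         \<and> fst (snd x) = turn_matching l (snd (snd x))}
      = (\<lambda>(V, \<mu>). (V, turn_matching l \<mu>, \<mu>)) ` (SIGMA V : ?\<V>. trapezoid_matchings 0 l h (P \<union> V))"
    (is "?L = ?R")
  proof (intro equalityI subsetI)
    fix x assume "x \<in> ?L"
    then obtain V \<mu> where x: "x = (V, turn_matching l \<mu>, \<mu>)" "V \<subseteq> ?J - \<beta>" "reflect (l - 1) V = V"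
        "(turn_matching l \<mu>, \<mu>) \<in> halves 0 ?A ?E V"
      by (cases x) auto
    then have "V \<in> ?\<V>" "\<mu> \<in> trapezoid_matchings 0 l h (P \<union> V)"
      unfolding hexagon_halves crossing_columns_eq by auto
    then show "x \<in> ?R" using x(1) by (intro image_eqI[of _ _ "(V, \<mu>)"]) auto
  next
    fix x assume "x \<in> ?R"
    then obtain y where y: "x = (\<lambda>(V, \<mu>). (V, turn_matching l \<mu>, \<mu>)) y"
        "y \<in> (SIGMA V : ?\<V>. trapezoid_matchings 0 l h (P \<union> V))"
      by (rule imageE)
    obtain V \<mu> where "y = (V, \<mu>)" by (cases y)
    then have x: "x = (V, turn_matching l \<mu>, \<mu>)" "V \<in> ?\<V>"
        "\<mu> \<in> trapezoid_matchings 0 l h (P \<union> V)"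
      using y by simp_all
    then have "V \<subseteq> ?J - \<beta>" unfolding crossing_columns_eq by auto
    moreover have "(turn_matching l \<mu>, \<mu>) \<in> halves 0 ?A ?E V"
      using x(2,3) unfolding hexagon_halves by auto
    ultimately show "x \<in> ?L" using x(1,2) by auto
  qed
  have "card {\<mu> \<in> matchings ?A ?E. (\<forall>i\<in>\<beta>. ((i, 0), (i, 0)) \<notin> \<mu>) \<and> turn_matching l \<mu> = \<mu>}
      = card ((\<lambda>(V, \<mu>). (V, turn_matching l \<mu>, \<mu>)) ` (SIGMA V : ?\<V>. trapezoid_matchings 0 l h (P \<union> V)))"
    using bij_betw_same_card[OF bij] unfolding LR .
  also have "\<dots> = card (SIGMA V : ?\<V>. trapezoid_matchings 0 l h (P \<union> V))"
    by (intro card_image) (auto simp: inj_on_def)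
  also have "\<dots> = (\<Sum>V\<in>?\<V>. card (trapezoid_matchings 0 l h (P \<union> V)))"
    by (intro card_SigmaI) (auto intro!: finite_matchings finite_trapezoid)
  finally show ?thesis .
qed

section \<open>Factoring out the removed triangles\<close>

lemma \<Delta>_column: "\<Delta> (column ` S) = \<Delta> S"
  unfolding \<Delta>_def
  by (rule prod.reindex_bij_witness[of _ "\<lambda>(p, q). (column p, column q)" "\<lambda>(p, q). (p + 1, q + 1)"])
    (auto simp: column_def)

lemma \<Delta>_reflect: "\<Delta> (reflect m S) = \<Delta> S"
  unfolding \<Delta>_def
  by (rule prod.reindex_bij_witness[of _ "\<lambda>(p, q). (m - q, m - p)" "\<lambda>(p, q). (m - q, m - p)"]) auto

definition distance_prod :: "int set \<Rightarrow> int \<Rightarrow> int" where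
  "distance_prod V p = (\<Prod>v\<in>V. \<bar>v - p\<bar>)"

lemma distance_prod_reflect: "distance_prod (reflect m V) p = distance_prod V (m - p)"
  unfolding distance_prod_def
  by (rule prod.reindex_bij_witness[of _ "\<lambda>v. m - v" "\<lambda>v. m - v"]) auto

text \<open>The pairs in \<open>P \<union> V\<close> are those within \<open>P\<close>, those within \<open>V\<close>, and the mixed ones, which contribute
their distance whichever element is larger.\<close>

lemma \<Delta>_Un:
  assumes "finite P" "finite V" "P \<inter> V = {}"
  shows "\<Delta> (P \<union> V) = \<Delta> P * \<Delta> V * (\<Prod>p\<in>P. distance_prod V p)"
proof -
  define X where "X = (\<lambda>S T. {(p, q) \<in> S \<times> T. p < (q::int)})"
  have fin: "finite (X S T)" if "finite S" "finite T" for S T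
    by (rule finite_subset[OF _ finite_cartesian_product[OF that]]) (auto simp: X_def)
  let ?d = "\<lambda>(p, q). q - p :: int"
  have "(\<Prod>p\<in>P. distance_prod V p) = (\<Prod>(p, v)\<in>P \<times> V. \<bar>v - p\<bar>)"
    unfolding distance_prod_def by (rule prod.cartesian_product)
  also have "P \<times> V = X P V \<union> (\<lambda>(v, p). (p, v)) ` X V P"
    using assms(3) by (fastforce simp: X_def)
  also have "(\<Prod>(p, v)\<in>X P V \<union> (\<lambda>(v, p). (p, v)) ` X V P. \<bar>v - p\<bar>)
      = (\<Prod>(p, v)\<in>X P V. \<bar>v - p\<bar>) * (\<Prod>(p, v)\<in>(\<lambda>(v, p). (p, v)) ` X V P. \<bar>v - p\<bar>)"
    using assms fin by (intro prod.union_disjoint) (auto simp: X_def)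
  also have "(\<Prod>(p, v)\<in>X P V. \<bar>v - p\<bar>) = prod ?d (X P V)"
    by (intro prod.cong) (auto simp: X_def)
  also have "(\<Prod>(p, v)\<in>(\<lambda>(v, p). (p, v)) ` X V P. \<bar>v - p\<bar>) = prod ?d (X V P)"
    by (subst prod.reindex) (auto simp: X_def inj_on_def intro!: prod.cong)
  finally have cross: "(\<Prod>p\<in>P. distance_prod V p) = prod ?d (X P V) * prod ?d (X V P)" .
  have "X (P \<union> V) (P \<union> V) = (X P P \<union> X V V) \<union> (X P V \<union> X V P)"
    by (auto simp: X_def)
  then have "prod ?d (X (P \<union> V) (P \<union> V)) = prod ?d ((X P P \<union> X V V) \<union> (X P V \<union> X V P))"
    by simp
  also have "\<dots> = prod ?d (X P P \<union> X V V) * prod ?d (X P V \<union> X V P)"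
    using assms fin by (intro prod.union_disjoint) (auto simp: X_def)
  also have "prod ?d (X P P \<union> X V V) = prod ?d (X P P) * prod ?d (X V V)"
    using assms fin by (intro prod.union_disjoint) (auto simp: X_def)
  also have "prod ?d (X P V \<union> X V P) = prod ?d (X P V) * prod ?d (X V P)"
    using assms fin by (intro prod.union_disjoint) (auto simp: X_def)
  finally show ?thesis
    unfolding cross by (simp add: \<Delta>_def X_def mult_ac)
qed

lemma finite_reflect [simp]: "finite V \<Longrightarrow> finite (reflect m V)"
  by (simp add: reflect_def)

lemma card_reflect [simp]: "card (reflect m V) = card V"
  unfolding reflect_def by (rule card_image) (simp add: inj_on_def)

lemma prod_reflect: "(\<Prod>p\<in>reflect m D. g p) = (\<Prod>p\<in>D. g (m - p :: int))"
  by (rule prod.reindex_bij_witness[of _ "\<lambda>v. m - v" "\<lambda>v. m - v"]) auto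

text \<open>The reason why only \<open>U \<union> D\<close> and \<open>U \<inter> D\<close> matter: for a function invariant under the reflection,
\<open>D\<close> can be reflected back onto the side of \<open>U\<close>, and each element of \<open>U \<inter> D\<close> is counted twice.\<close>

lemma prod_Un_reflect:
  fixes g :: "int \<Rightarrow> int"
  assumes "finite U" "finite D" "U \<inter> reflect m D = {}" and "\<And>p. g (m - p) = g p"
  shows "prod g (U \<union> reflect m D) = prod g (U \<union> D) * prod g (U \<inter> D)"
proof -
  have "prod g (U \<union> reflect m D) = prod g U * prod g (reflect m D)"
    using assms by (intro prod.union_disjoint) auto
  also have "prod g (reflect m D) = prod g D"
    by (simp add: prod_reflect assms(4))
  also have "prod g U * prod g D = prod g (U \<union> D) * prod g (U \<inter> D)"
    using assms by (simp add: prod.union_inter)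
  finally show ?thesis .
qed

text \<open>Only sets \<open>V\<close> of \<open>y\<close> columns contribute, as together with \<open>P\<close> they must form \<open>h\<close> dents.\<close>

lemma trapezoid_count_Un:
  fixes l :: int and h y :: nat
  assumes "int h \<le> l" "P \<subseteq> {0..<l}" "h = y + card P"
    and V: "V \<subseteq> crossing_columns l h P"
  shows "(\<Prod>i<h. fact i) * int (card (trapezoid_matchings 0 l h (P \<union> V)))
    = (if card V = y then \<Delta> P * \<Delta> V * (\<Prod>p\<in>P. distance_prod V p) else 0)"
proof -
  have fin: "finite P" "finite V" using assms finite_subset finite_crossing_columns by blast+
  have disj: "P \<inter> V = {}" using V by (auto simp: crossing_columns_def)
  have "(\<Prod>i<h. fact i) * int (card (trapezoid_matchings 0 l h (P \<union> V)))
      = (if card (P \<union> V) = h then \<Delta> (P \<union> V) else 0)"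
    using assms fin by (intro trapezoid_count) (auto simp: crossing_columns_def)
  then show ?thesis
    using fin disj assms(3) by (simp add: \<Delta>_Un card_Un_disjoint)
qed

definition crossing_sets :: "int \<Rightarrow> nat \<Rightarrow> nat \<Rightarrow> int set \<Rightarrow> int set \<Rightarrow> int set set" where
  "crossing_sets l h y W \<beta> = {V \<in> Pow (crossing_columns l h (W \<union> reflect (l - 1) W \<union> \<beta>)). card V = y}"

text \<open>The quotient of (a constant times) the number of tilings by \<open>(\<Delta> P)\<^sup>2\<close>. The set of removed
triangles enters only through \<open>W\<close>, which stands for \<open>U \<union> D\<close>, and \<open>I\<close>, which stands for \<open>U \<inter> D\<close>.\<close>

definition total_weight :: "int \<Rightarrow> nat \<Rightarrow> nat \<Rightarrow> int set \<Rightarrow> int set \<Rightarrow> int set \<Rightarrow> int" where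
  "total_weight l h y W I \<beta> = (\<Sum>V\<in>crossing_sets l h y W \<beta>. (\<Delta> V)\<^sup>2 *
     ((\<Prod>p\<in>W. distance_prod V p * distance_prod V (l - 1 - p))
       * (\<Prod>p\<in>I. distance_prod V p * distance_prod V (l - 1 - p))))"

text \<open>The analogue for centrally symmetric tilings, where only one half contributes, so that \<open>\<Delta> P\<close>,
\<open>\<Delta> V\<close> and the distances occur to the first power.\<close>

definition symmetric_weight :: "int \<Rightarrow> nat \<Rightarrow> nat \<Rightarrow> int set \<Rightarrow> int set \<Rightarrow> int set \<Rightarrow> int" where
  "symmetric_weight l h y W I \<beta> = (\<Sum>V\<in>{V \<in> crossing_sets l h y W \<beta>. reflect (l - 1) V = V}. \<Delta> V *
     ((\<Prod>p\<in>W. distance_prod V p) * (\<Prod>p\<in>I. distance_prod V p)))"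

text \<open>Write both counts as sums over the crossing columns \<open>V\<close> and apply the product formula to each
trapezoid. The distances between \<open>P\<close> and \<open>V\<close> enter through a product over \<open>P\<close> of a function that is
invariant under the reflection: for all tilings because the two halves see \<open>V\<close> and its mirror
image, for symmetric ones because \<open>V\<close> is its own mirror image.\<close>

lemma hexagon_count_weight:
  fixes l :: int and h y :: nat
  assumes hl: "int h \<le> l" and P: "P = U \<union> reflect (l - 1) D" "U \<inter> reflect (l - 1) D = {}"
    and sub: "P \<subseteq> {0..<l}" and h: "h = y + card P"
  shows "(\<Prod>i<h. fact i)\<^sup>2 * int (card {\<mu> \<in> hexagon_matchings l h P. \<forall>i\<in>\<beta>. ((i, 0), (i, 0)) \<notin> \<mu>})
      = (\<Delta> P)\<^sup>2 * total_weight l h y (U \<union> D) (U \<inter> D) \<beta>"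
    and "(\<Prod>i<h. fact i) * int (card {\<mu> \<in> hexagon_matchings l h P.
        (\<forall>i\<in>\<beta>. ((i, 0), (i, 0)) \<notin> \<mu>) \<and> turn_matching l \<mu> = \<mu>})
      = \<Delta> P * symmetric_weight l h y (U \<union> D) (U \<inter> D) \<beta>"
proof -
  let ?c = "(\<Prod>i<h. fact i) :: int" and ?\<rho> = "reflect (l - 1)"
  let ?F = "crossing_columns l h (P \<union> ?\<rho> P \<union> \<beta>)"
  let ?N = "\<lambda>V. int (card (trapezoid_matchings 0 l h (P \<union> V)))"
  have "finite P" using sub finite_subset by blast
  then have "finite U" "finite (?\<rho> D)" using P(1) by auto
  then have fin: "finite U" "finite D" using finite_reflect[of "?\<rho> D" "l - 1"] by auto
  have F: "?F = crossing_columns l h ((U \<union> D) \<union> ?\<rho> (U \<union> D) \<union> \<beta>)"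
    unfolding P(1) by (auto simp: crossing_columns_def)
  have N: "?c * ?N V = (if card V = y then \<Delta> P * \<Delta> V * (\<Prod>p\<in>P. distance_prod V p) else 0)"
    "?c * ?N (?\<rho> V) = (if card V = y then \<Delta> P * \<Delta> V * (\<Prod>p\<in>P. distance_prod V (l - 1 - p)) else 0)"
    if "V \<in> Pow ?F" for V
  proof -
    have "V \<subseteq> crossing_columns l h P" using that by (auto simp: crossing_columns_def)
    moreover have "?\<rho> V \<subseteq> crossing_columns l h P"
    proof
      fix i assume "i \<in> ?\<rho> V"
      then have "l - 1 - i \<in> ?F" using that by auto
      then show "i \<in> crossing_columns l h P" by (auto simp: crossing_columns_def)
    qed
    ultimately show "?c * ?N V = (if card V = y then \<Delta> P * \<Delta> V * (\<Prod>p\<in>P. distance_prod V p) else 0)"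
      "?c * ?N (?\<rho> V) = (if card V = y then \<Delta> P * \<Delta> V * (\<Prod>p\<in>P. distance_prod V (l - 1 - p)) else 0)"
      using trapezoid_count_Un[OF hl sub h, of V] trapezoid_count_Un[OF hl sub h, of "?\<rho> V"]
      by (simp_all add: \<Delta>_reflect distance_prod_reflect)
  qed
  have "?c\<^sup>2 * int (card {\<mu> \<in> hexagon_matchings l h P. \<forall>i\<in>\<beta>. ((i, 0), (i, 0)) \<notin> \<mu>})
      = (\<Sum>V\<in>Pow ?F. (?c * ?N V) * (?c * ?N (?\<rho> V)))"
    unfolding hexagon_count by (simp add: sum_distrib_left power2_eq_square mult_ac)
  also have "\<dots> = (\<Sum>V\<in>Pow ?F. if card V = y then (\<Delta> P)\<^sup>2 * ((\<Delta> V)\<^sup>2 *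
      (\<Prod>p\<in>P. distance_prod V p * distance_prod V (l - 1 - p))) else 0)"
    by (intro sum.cong refl) (simp add: N prod.distrib power2_eq_square mult_ac)
  also have "\<dots> = (\<Delta> P)\<^sup>2 * (\<Sum>V\<in>crossing_sets l h y (U \<union> D) \<beta>. (\<Delta> V)\<^sup>2 *
      (\<Prod>p\<in>P. distance_prod V p * distance_prod V (l - 1 - p)))"
    unfolding crossing_sets_def F[symmetric] sum_distrib_left
    by (rule sum.inter_filter[symmetric]) simp
  also have "\<dots> = (\<Delta> P)\<^sup>2 * total_weight l h y (U \<union> D) (U \<inter> D) \<beta>"
  proof -
    have "(\<Prod>p\<in>P. distance_prod V p * distance_prod V (l - 1 - p))
        = (\<Prod>p\<in>U \<union> D. distance_prod V p * distance_prod V (l - 1 - p))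
          * (\<Prod>p\<in>U \<inter> D. distance_prod V p * distance_prod V (l - 1 - p))" for V
      unfolding P(1) by (rule prod_Un_reflect[OF fin P(2)]) (simp add: mult.commute)
    then show ?thesis unfolding total_weight_def by simp
  qed
  finally show "?c\<^sup>2 * int (card {\<mu> \<in> hexagon_matchings l h P. \<forall>i\<in>\<beta>. ((i, 0), (i, 0)) \<notin> \<mu>})
      = (\<Delta> P)\<^sup>2 * total_weight l h y (U \<union> D) (U \<inter> D) \<beta>" .
  have "?c * int (card {\<mu> \<in> hexagon_matchings l h P.
        (\<forall>i\<in>\<beta>. ((i, 0), (i, 0)) \<notin> \<mu>) \<and> turn_matching l \<mu> = \<mu>})
      = (\<Sum>V\<in>{V \<in> Pow ?F. ?\<rho> V = V}. ?c * ?N V)"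
    unfolding hexagon_count_symmetric by (simp add: sum_distrib_left)
  also have "\<dots> = (\<Sum>V\<in>{V \<in> Pow ?F. ?\<rho> V = V}. if card V = y
      then \<Delta> P * (\<Delta> V * (\<Prod>p\<in>P. distance_prod V p)) else 0)"
    by (intro sum.cong refl) (simp add: N)
  also have "\<dots> = \<Delta> P * (\<Sum>V\<in>{V \<in> {V \<in> Pow ?F. ?\<rho> V = V}. card V = y}.
      \<Delta> V * (\<Prod>p\<in>P. distance_prod V p))"
    by (subst sum.inter_filter) (auto simp: sum_distrib_left if_distrib cong: if_cong)
  also have "{V \<in> {V \<in> Pow ?F. ?\<rho> V = V}. card V = y}
      = {V \<in> crossing_sets l h y (U \<union> D) \<beta>. ?\<rho> V = V}"
    unfolding crossing_sets_def F[symmetric] by auto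
  also have "(\<Sum>V\<in>\<dots>. \<Delta> V * (\<Prod>p\<in>P. distance_prod V p)) = symmetric_weight l h y (U \<union> D) (U \<inter> D) \<beta>"
  proof -
    have "(\<Prod>p\<in>P. distance_prod V p) = (\<Prod>p\<in>U \<union> D. distance_prod V p) * (\<Prod>p\<in>U \<inter> D. distance_prod V p)"
      if "?\<rho> V = V" for V
      unfolding P(1)
      by (rule prod_Un_reflect[OF fin P(2)]) (metis distance_prod_reflect that)
    then show ?thesis unfolding symmetric_weight_def by (intro sum.cong) auto
  qed
  finally show "?c * int (card {\<mu> \<in> hexagon_matchings l h P.
        (\<forall>i\<in>\<beta>. ((i, 0), (i, 0)) \<notin> \<mu>) \<and> turn_matching l \<mu> = \<mu>})
      = \<Delta> P * symmetric_weight l h y (U \<union> D) (U \<inter> D) \<beta>" .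
qed

lemma inj_column: "inj column"
  by (simp add: inj_on_def column_def)

text \<open>It is essential that \<open>h\<close> is a function of \<open>U \<union> D\<close> and \<open>U \<inter> D\<close> as well: \<open>card U + card D\<close> equals
\<open>card (U \<union> D) + card (U \<inter> D)\<close>. Since \<open>U\<close> and \<open>D\<close> lie in the left half of the axis, \<open>U\<close> and the
mirror image of \<open>D\<close> are disjoint.\<close>

lemma M_weight:
  fixes x y n :: nat and U D B :: "int set"
  assumes U: "U \<subseteq> {1..(int x + int y + 2 * int n) div 2}"
    and D: "D \<subseteq> {1..(int x + int y + 2 * int n) div 2}"
    and n: "card (U \<union> D) = n"
  defines "l \<equiv> int x + int y + 2 * int n"
    and "h \<equiv> y + card (U \<union> D) + card (U \<inter> D)"
    and "W \<equiv> column ` (U \<union> D)" and "I \<equiv> column ` (U \<inter> D)"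
  defines "\<beta> \<equiv> column ` (B \<union> reflect (l + 1) B)"
  shows "(\<Prod>i<h. fact i)\<^sup>2 * int (M x y U D B) = (\<Delta> (U \<union> reflect (l + 1) D))\<^sup>2 * total_weight l h y W I \<beta>"
    and "(\<Prod>i<h. fact i) * int (M\<^sub>c x y U D B) = \<Delta> (U \<union> reflect (l + 1) D) * symmetric_weight l h y W I \<beta>"
proof -
  have fin: "finite U" "finite D" using U D finite_subset by blast+
  have l: "l = axis_length x y U D" by (simp add: l_def axis_length_def n)
  have h: "h = y + card U + card D" using card_Un_Int[OF fin] by (simp add: h_def)
  define P where "P = column ` (U \<union> reflect (l + 1) D)"
  have P: "P = column ` U \<union> reflect (l - 1) (column ` D)"
    unfolding P_def by (simp add: reflect_def image_Un image_image column_def)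
  have disj: "U \<inter> reflect (l + 1) D = {}"
    using U D unfolding l_def[symmetric] by fastforce
  then have disj': "column ` U \<inter> reflect (l - 1) (column ` D) = {}"
  proof -
    have "l - i \<noteq> j - 1" if "i \<in> U" "j \<in> D" for i j
    proof
      assume "l - i = j - 1"
      then have "l + 1 - i = j" by simp
      then show False using disj that by (metis IntI empty_iff in_reflect)
    qed
    then show ?thesis by (auto simp: column_def)
  qed
  have sub: "P \<subseteq> {0..<l}"
    using U D unfolding P_def l_def[symmetric] by (fastforce simp: column_def)
  have "card P = card (U \<union> reflect (l + 1) D)"
    unfolding P_def by (intro card_image inj_on_subset[OF inj_column]) simp
  then have hP: "h = y + card P"
    using h disj fin by (simp add: card_Un_disjoint)
  have "card U \<le> n" "card D \<le> n" using n fin by (auto intro: card_mono simp flip: n)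
  then have hl: "int h \<le> l" unfolding h l_def by linarith
  have WI: "W = column ` U \<union> column ` D" "I = column ` U \<inter> column ` D"
    by (simp_all add: W_def I_def image_Un image_Int[OF inj_column])
  note count = hexagon_count_weight[OF hl P disj' sub hP, of \<beta>, folded WI]
  have \<Delta>P: "\<Delta> P = \<Delta> (U \<union> reflect (l + 1) D)" by (simp add: P_def \<Delta>_column)
  have \<beta>: "\<beta> = column ` (B \<union> reflect (l + 1) B)" by (simp add: \<beta>_def)
  show "(\<Prod>i<h. fact i)\<^sup>2 * int (M x y U D B) = (\<Delta> (U \<union> reflect (l + 1) D))\<^sup>2 * total_weight l h y W I \<beta>"
    using count(1) unfolding M_eq_card(1)[OF l h P_def \<beta>] \<Delta>P .
  show "(\<Prod>i<h. fact i) * int (M\<^sub>c x y U D B) = \<Delta> (U \<union> reflect (l + 1) D) * symmetric_weight l h y W I \<beta>"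
    using count(2) unfolding M_eq_card(2)[OF l h P_def \<beta>] \<Delta>P .
qed

theorem theorem1p2:
  fixes x y n u d u' d' b :: nat
    and U D U' D' B :: "int set"
  assumes "U \<subseteq> {1..(int x + int y + 2 * int n) div 2}"
    and "D \<subseteq> {1..(int x + int y + 2 * int n) div 2}"
    and "U' \<subseteq> {1..(int x + int y + 2 * int n) div 2}"
    and "D' \<subseteq> {1..(int x + int y + 2 * int n) div 2}"
    and "B \<subseteq> {1..(int x + int y + 2 * int n) div 2}"
    and "card U = u" and "card D = d"
    and "card U' = u'" and "card D' = d'"
    and "card B = b"
    and "card (U \<union> D) = n"
    and "U \<union> D = U' \<union> D'"
    and "U \<inter> D = U' \<inter> D'"
    and "B \<inter> (U \<union> D) = {}"
    and "2 * b \<le> x"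
  shows "int (M\<^sub>c x y U D B) * \<Delta> (U' \<union> reflect (int x + int y + 2 * int n + 1) D')
           = int (M\<^sub>c x y U' D' B) * \<Delta> (U \<union> reflect (int x + int y + 2 * int n + 1) D)
       \<and> int (M x y U D B) * (\<Delta> (U' \<union> reflect (int x + int y + 2 * int n + 1) D'))\<^sup>2
           = int (M x y U' D' B) * (\<Delta> (U \<union> reflect (int x + int y + 2 * int n + 1) D))\<^sup>2"
proof -
  let ?l = "int x + int y + 2 * int n" and ?h = "y + card (U \<union> D) + card (U \<inter> D)"
  let ?c = "(\<Prod>i<?h. fact i) :: int"
  let ?\<Delta> = "\<Delta> (U \<union> reflect (?l + 1) D)" and ?\<Delta>' = "\<Delta> (U' \<union> reflect (?l + 1) D')"
  let ?\<beta> = "column ` (B \<union> reflect (?l + 1) B)"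
  let ?K = "total_weight ?l ?h y (column ` (U \<union> D)) (column ` (U \<inter> D)) ?\<beta>"
  let ?K\<^sub>c = "symmetric_weight ?l ?h y (column ` (U \<union> D)) (column ` (U \<inter> D)) ?\<beta>"
  have n': "card (U' \<union> D') = n" using assms(11,12) by simp
  note w = M_weight[OF assms(1,2,11), of B]
  note w' = M_weight[OF assms(3,4) n', of B, folded assms(12,13)]
  have c: "?c \<noteq> 0" by simp
  have "?c * (int (M\<^sub>c x y U D B) * ?\<Delta>') = ?\<Delta> * ?K\<^sub>c * ?\<Delta>'"
    using w(2) by (simp add: mult.assoc[symmetric])
  also have "\<dots> = ?c * (int (M\<^sub>c x y U' D' B) * ?\<Delta>)"
    using w'(2) by (simp add: mult_ac)
  finally have 1: "int (M\<^sub>c x y U D B) * ?\<Delta>' = int (M\<^sub>c x y U' D' B) * ?\<Delta>"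
    using c by simp
  have "?c\<^sup>2 * (int (M x y U D B) * ?\<Delta>'\<^sup>2) = ?\<Delta>\<^sup>2 * ?K * ?\<Delta>'\<^sup>2"
    using w(1) by (simp add: mult.assoc[symmetric])
  also have "\<dots> = ?c\<^sup>2 * (int (M x y U' D' B) * ?\<Delta>\<^sup>2)"
    using w'(1) by (simp add: mult_ac)
  finally have 2: "int (M x y U D B) * ?\<Delta>'\<^sup>2 = int (M x y U' D' B) * ?\<Delta>\<^sup>2"
    using c by simp
  show ?thesis using 1 2 by blast
qed

end
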